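(* Let $X=X_1\times\dots\times X_N$, where $X_1,\dots,X_N\subset\mathbb{R}^d$ are convex, compact subsets with nonempty interior. Assume $f_1,\dots,f_N:X\to\mathbb{R}$ are continuous; that for each $x\in X$ the function $X\ni y\mapsto\sum_{j=1}^N f_j(y_j,x_{-j})$ is convex; and that $\sum_{j=1}^N(p_j-q_j)\cdot(x_j-y_j)\ge0$ for all $x,y\in X$ and all $p_j\in\partial_{x_j}f_j(x)$, $q_j\in\partial_{x_j}f_j(y)$ $(j=1,\dots,N)$. Then for each $u^0\in\mathcal{D}$ there is a unique Lipschitz continuous $u:[0,\infty)\to\mathbb{R}^{Nd}$ with $u(t)\in\mathcal{D}$ for $t\ge0$ which satisfies $$u(0)=u^0,\qquad \sum_{j=1}^N(\dot u_j(t)+\partial_{x_j}f_j(u(t)))\cdot(y_j-u_j(t))\ge0\ \text{ for a.e. }t\ge0\text{ and each }y\in X.$$ Furthermore, the limit $\lim_{t\to\infty}\frac1t\int_0^tu(s)\,ds$ exists and equals a Nash equilibrium of $f_1,\dots,f_N$.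
   Context: For $x\in X$ and $y_j\in X_j$, $(y_j,x_{-j})$ is the point of $X$ obtained from $x$ by replacing the $j$-th coordinate $x_j$ by $y_j$. A Nash equilibrium of $f_1,\dots,f_N$ is $x\in X$ with $f_j(x)\le f_j(y_j,x_{-j})$ for all $y_j\in X_j$ and all $j$. For $x\in X$, $\partial_{x_j}f_j(x):=\{\zeta\in\mathbb{R}^d: f_j(z,x_{-j})\ge f_j(x)+\zeta\cdot(z-x_j)\ \text{for all } z\in X_j\}$. The normal cone is $n_{X_j}(z)=\{\zeta\in\mathbb{R}^d:\zeta\cdot(y-z)\le0\text{ for all }y\in X_j\}$. Set $$\mathcal{D}=\{x\in X:\partial_{x_j}f_j(x)+n_{X_j}(x_j)\ne\emptyset\text{ for each }j=1,\dots,N\}.$$ The inequality in the initial value problem means: for a.e. $t\ge0$ there are $p_j\in\partial_{x_j}f_j(u(t))$, $j=1,\dots,N$, with $\sum_{j}(\dot u_j(t)+p_j)\cdot(y_j-u_j(t))\ge0$ for every $y\in X$. *)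

theory Defs
  imports "HOL-Analysis.Analysis"
begin

text \<open>
  \<open>real^'d^'n\<close> is \<open>\<real>\<^sup>N\<^sup>d\<close> with \<open>N = CARD('n)\<close> and \<open>d = CARD('d)\<close>: \<open>x $ j\<close> is the block
  \<open>x\<^sub>j \<in> \<real>\<^sup>d\<close> of player \<open>j\<close>, and the norm is the Euclidean one.
  The cost functions \<open>f j\<close> are total, but only their values on the product set matter below.
\<close>

definition prod_set :: "('n::finite \<Rightarrow> (real^'d) set) \<Rightarrow> (real^'d^'n) set" where
  "prod_set K = {x. \<forall>j. x $ j \<in> K j}"

text \<open>The point \<open>(z, x\<^sub>-\<^sub>j)\<close>:\<close>

definition replace_coord :: "real^'d^'n \<Rightarrow> 'n::finite \<Rightarrow> real^'d \<Rightarrow> real^'d^'n" where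
  "replace_coord x j z = (\<chi> i. if i = j then z else x $ i)"

definition nash_equilibrium ::
    "('n::finite \<Rightarrow> (real^'d) set) \<Rightarrow> ('n \<Rightarrow> real^'d^'n \<Rightarrow> real) \<Rightarrow> real^'d^'n \<Rightarrow> bool" where
  "nash_equilibrium K f x \<longleftrightarrow>
     x \<in> prod_set K \<and> (\<forall>j. \<forall>z\<in>K j. f j x \<le> f j (replace_coord x j z))"

text \<open>Test points range over \<open>K j\<close> only, so at boundary points this set may be empty or unbounded.\<close>

definition partial_subdiff ::
    "('n::finite \<Rightarrow> (real^'d) set) \<Rightarrow> ('n \<Rightarrow> real^'d^'n \<Rightarrow> real) \<Rightarrow> 'n \<Rightarrow> real^'d^'n \<Rightarrow> (real^'d) set" where
  "partial_subdiff K f j x =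
     {\<zeta>. \<forall>z\<in>K j. f j (replace_coord x j z) \<ge> f j x + \<zeta> \<bullet> (z - x $ j)}"

definition normal_cone :: "'a::real_inner set \<Rightarrow> 'a \<Rightarrow> 'a set" where
  "normal_cone S z = {\<zeta>. \<forall>y\<in>S. \<zeta> \<bullet> (y - z) \<le> 0}"

text \<open>The sum in the next definition is the Minkowski sum of sets.\<close>

definition game_domain ::
    "('n::finite \<Rightarrow> (real^'d) set) \<Rightarrow> ('n \<Rightarrow> real^'d^'n \<Rightarrow> real) \<Rightarrow> (real^'d^'n) set" where
  "game_domain K f =
     {x \<in> prod_set K. \<forall>j. partial_subdiff K f j x + normal_cone (K j) (x $ j) \<noteq> {}}"

text \<open>
  A solution is a function on \<open>[0,\<infinity>)\<close>; its values at negative times are irrelevant.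
  The vector \<open>w\<close> is the derivative \<open>du/dt\<close> at \<open>t\<close>, and the selection \<open>p\<close> may depend on \<open>t\<close>
  but not on the test point \<open>y\<close>.
\<close>

definition flow_solution ::
    "('n::finite \<Rightarrow> (real^'d) set) \<Rightarrow> ('n \<Rightarrow> real^'d^'n \<Rightarrow> real) \<Rightarrow> real^'d^'n \<Rightarrow>
      (real \<Rightarrow> real^'d^'n) \<Rightarrow> bool" where
  "flow_solution K f u0 u \<longleftrightarrow>
     (\<exists>L. L-lipschitz_on {0..} u) \<and>
     (\<forall>t\<ge>0. u t \<in> game_domain K f) \<and>
     u 0 = u0 \<and>
     (AE t in lebesgue_on {0..}.
        \<exists>w p. (u has_vector_derivative w) (at t within {0..}) \<and>
              (\<forall>j. p j \<in> partial_subdiff K f j (u t)) \<and>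
              (\<forall>y\<in>prod_set K. (\<Sum>j\<in>UNIV. (w $ j + p j) \<bullet> (y $ j - u t $ j)) \<ge> 0))"

end

theory Submission
  imports Defs
begin

text \<open>
  Write \<open>A x\<close> for the product over \<open>j\<close> of the partial subdifferentials of \<open>f j\<close> at
  \<open>x\<close>. Test points are confined to \<open>K j\<close>, so adding normal vectors does not enlarge \<open>A x\<close>, and the
  initial value problem is the differential inclusion \<open>- u' \<in> A u\<close>
  (\<open>game_operator_iff_variational\<close>), while the Nash equilibria are the zeros of \<open>A\<close>. The
  theorem is then an instance of the theory of evolution inclusions for maximal monotone operators (Minty,
  Komura, Brezis, Crandall, Liggett, Baillon), in Euclidean space.

  \<^emph>\<open>Maximality.\<close> The operator is monotone by hypothesis. That \<open>x + h A x\<close> covers the whole space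
  (\<open>game_operator_surjective\<close>) means that the game with the proximal cost \<open>\<bar>y - z\<bar>\<^sup>2/2h\<close> added
  has a Nash equilibrium. The proximal term makes the best reply to each \<open>x\<close> unique, hence
  continuous in \<open>x\<close>, and Brouwer's theorem gives a fixed point. By Minty's argument (\<open>maximal\<close>), a
  pair which is monotonically related to the whole graph of \<open>A\<close> then belongs to it. This is how
  membership in \<open>A\<close> is obtained everywhere below: monotonicity inequalities survive limits.

  \<^emph>\<open>Existence.\<close> The implicit Euler iterates \<open>(I + hA)\<^sup>-\<^sup>1\<close> are nonexpansive and take steps of length at
  most \<open>h |v|\<close> for any \<open>v \<in> A (u 0)\<close>. They satisfy a discrete energy inequality, relating the growth of
  \<open>|u - y|\<^sup>2\<close> to \<open>w \<bullet> (y - u)\<close> for each \<open>w \<in> A y\<close>. Tychonoff's theorem gives a limit curve for which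
  the inequality persists (\<open>euler_limit\<close>). Any limit of its difference quotients at \<open>s\<close> lies in
  \<open>- A (u s)\<close>, by the energy inequality and maximality. The element \<open>a s\<close> of least norm of \<open>A (u s)\<close>
  bounds the forward quotients (\<open>sharp_Lipschitz\<close>), so the right derivative is \<open>- a s\<close> everywhere.
  Since the norm of \<open>a\<close> does not increase along the curve, it has only countably many discontinuities, and
  elsewhere the left derivative agrees. Thus differentiability almost everywhere comes from the
  inclusion itself.

  \<^emph>\<open>Uniqueness.\<close> By monotonicity the distance of two solutions has derivative at most zero
  almost everywhere; being Lipschitz, it is nonincreasing (\<open>solution_contraction\<close>).

  \<^emph>\<open>Averages.\<close> Averaging the energy inequality over \<open>[0,t]\<close> shows that each cluster point of the means is
  a zero of \<open>A\<close>. The distance of \<open>u\<close> to each zero is nonincreasing and so converges. If \<open>p\<close> and \<open>q\<close> are zeros,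
  \<open>u t \<bullet> (p - q)\<close> is an affine function of the two squared distances and therefore
  converges; its means converge to the same limit, which forces two cluster points of the means to coincide
  (\<open>solution_average_tendsto\<close>).
\<close>

section \<open>Cluster points along filters\<close>

text \<open>
  Finer filters take the place of convergent subsequences. They also serve in spaces that are compact but not
  sequentially compact, such as the space of all curves with the topology of pointwise convergence.
\<close>

lemma compact_cluster:
  fixes f :: "'a \<Rightarrow> 'b::topological_space"
  assumes "compact K" "F \<noteq> bot" "\<forall>\<^sub>F x in F. f x \<in> K"
  obtains G p where "G \<le> F" "G \<noteq> bot" "p \<in> K" "(f \<longlongrightarrow> p) G"
proof -
  have "filtermap f F \<noteq> bot" "eventually (\<lambda>y. y \<in> K) (filtermap f F)"
    using assms by (auto simp: eventually_filtermap filtermap_bot_iff)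
  then obtain p where p: "p \<in> K" "inf (nhds p) (filtermap f F) \<noteq> bot"
    using assms(1) unfolding compact_filter by blast
  \<comment> \<open>the coarsest filter below \<open>F\<close> along which \<open>f\<close> tends to \<open>p\<close>\<close>
  define G where "G = inf (filtercomap f (nhds p)) F"
  have "G \<noteq> bot"
  proof
    assume "G = bot"
    then have "eventually (\<lambda>_. False) G" by simp
    then obtain Q R where QR: "eventually Q (filtercomap f (nhds p))" "eventually R F"
      "\<And>x. Q x \<Longrightarrow> R x \<Longrightarrow> False"
      unfolding G_def eventually_inf by blast
    then obtain P where P: "eventually P (nhds p)" "\<And>x. P (f x) \<Longrightarrow> Q x"
      unfolding eventually_filtercomap by blast
    have "eventually (\<lambda>y. \<not> P y) (filtermap f F)"
      unfolding eventually_filtermap using QR(2) by eventually_elim (use QR(3) P(2) in blast)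
    then have "eventually (\<lambda>_. False) (inf (nhds p) (filtermap f F))"
      unfolding eventually_inf using P(1) by blast
    with p(2) show False by (simp add: trivial_limit_def)
  qed
  moreover have "(f \<longlongrightarrow> p) G"
    unfolding G_def filterlim_def
    by (meson filtermap_filtercomap filtermap_mono inf_le1 order_trans)
  ultimately show ?thesis using that[of G p] p(1) by (simp add: G_def)
qed

lemma tendsto_if_unique_cluster:
  fixes f :: "'a \<Rightarrow> 'b::topological_space"
  assumes "compact K" "\<forall>\<^sub>F x in F. f x \<in> K"
    and uniq: "\<And>G p. \<lbrakk>G \<le> F; G \<noteq> bot; p \<in> K; (f \<longlongrightarrow> p) G\<rbrakk> \<Longrightarrow> p = l"
  shows "(f \<longlongrightarrow> l) F"
proof (rule topological_tendstoI, rule ccontr)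
  fix S assume S: "open S" "l \<in> S" and ev: "\<not> (\<forall>\<^sub>F x in F. f x \<in> S)"
  let ?F = "inf F (principal {x. f x \<notin> S})"
  have "?F \<noteq> bot"
    using ev by (simp add: trivial_limit_def eventually_inf_principal)
  moreover have "\<forall>\<^sub>F x in ?F. f x \<in> K"
    using assms(2) by (simp add: eventually_inf_principal eventually_mono)
  ultimately obtain G p where G: "G \<le> ?F" "G \<noteq> bot" "p \<in> K" "(f \<longlongrightarrow> p) G"
    using compact_cluster[OF assms(1)] by metis
  then have "p = l" by (intro uniq) auto
  then have "\<forall>\<^sub>F x in G. f x \<in> S"
    using G S topological_tendstoD by blast
  moreover have "\<forall>\<^sub>F x in G. f x \<notin> S"
    using filter_leD[OF G(1)] by (simp add: eventually_inf_principal)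
  ultimately have "\<forall>\<^sub>F x in G. False" by eventually_elim auto
  with G(2) show False by (simp add: trivial_limit_def)
qed

section \<open>Monotonicity from one-sided or almost-everywhere derivatives\<close>

text \<open>
  If \<open>\<psi> t = g t - e t\<close> increased strictly from \<open>a\<close> to \<open>b\<close>, some intermediate value \<open>c\<close> would be missed by the image
  of the exceptional set \<open>N\<close>, since that image is negligible. At the last time where \<open>\<psi> \<le> c\<close> the Dini condition
  then holds and keeps \<open>\<psi>\<close> below \<open>c\<close> a little longer. Only the image of \<open>N\<close> must be small, which covers
  null sets for a Lipschitz function as well as the empty set for a merely continuous one.
\<close>

lemma nonincreasing_if_Dini_nonpos:
  fixes g :: "real \<Rightarrow> real"
  assumes "a \<le> b" and cont: "continuous_on {a..b} g"
    and N: "\<And>e. e > 0 \<Longrightarrow> negligible ((\<lambda>t. g t - e * t) ` N)"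
    and dini: "\<And>t e. \<lbrakk>a \<le> t; t < b; t \<notin> N; e > 0\<rbrakk> \<Longrightarrow> \<forall>\<^sub>F s in at_right t. g s \<le> g t + e * (s - t)"
  shows "g b \<le> g a"
proof -
  have "g b - e * b \<le> g a - e * a" if "e > 0" for e
  proof (rule ccontr)
    define \<psi> where "\<psi> t = g t - e * t" for t
    assume "\<not> g b - e * b \<le> g a - e * a"
    then have less: "\<psi> a < \<psi> b" by (simp add: \<psi>_def)
    have "\<not> {\<psi> a<..<\<psi> b} \<subseteq> \<psi> ` N"
    proof
      assume "{\<psi> a<..<\<psi> b} \<subseteq> \<psi> ` N"
      then have "negligible {\<psi> a<..<\<psi> b}"
        using negligible_subset[OF N[OF that]] by (simp add: \<psi>_def[abs_def])
      moreover have "open {\<psi> a<..<\<psi> b}" "{\<psi> a<..<\<psi> b} \<noteq> {}" using less by auto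
      ultimately show False using open_not_negligible by blast
    qed
    then obtain c where "c \<in> {\<psi> a<..<\<psi> b}" and cN: "c \<notin> \<psi> ` N" by (meson subsetI)
    then have c: "\<psi> a < c" "c < \<psi> b" "c \<notin> \<psi> ` N" by auto
    have cont\<psi>: "continuous_on {a..b} \<psi>"
      unfolding \<psi>_def[abs_def] by (intro continuous_intros cont)
    define S where "S = {s \<in> {a..b}. \<psi> s \<le> c}"
    have "closed ({a..b} \<inter> \<psi> -` {..c})"
      by (intro continuous_closed_preimage cont\<psi>) auto
    then have "compact ({a..b} \<inter> ({a..b} \<inter> \<psi> -` {..c}))"
      by (rule compact_Int_closed[OF compact_Icc])
    also have "{a..b} \<inter> ({a..b} \<inter> \<psi> -` {..c}) = S" by (auto simp: S_def)
    finally have "compact S" .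
    moreover have "a \<in> S" using c(1) assms(1) by (simp add: S_def)
    ultimately obtain t where t: "t \<in> S" "\<And>s. s \<in> S \<Longrightarrow> s \<le> t"
      using compact_attains_sup[of S] by (metis empty_iff)
    then have tab: "a \<le> t" "t < b" using c by (auto simp: S_def order.strict_iff_order)
    have gt: "\<psi> s > c" if "t < s" "s \<le> b" for s
      using t(2)[of s] that tab by (force simp: S_def)
    obtain s where s: "t \<le> s" "s \<le> b" "\<psi> s = c"
      using IVT'[of \<psi> t c b] continuous_on_subset[OF cont\<psi>, of "{t..b}"] t(1) c tab
      by (auto simp: S_def)
    then have \<psi>t: "\<psi> t = c" using gt[of s] by (cases "s = t") auto
    have "\<forall>\<^sub>F s in at_right t. g s \<le> g t + (e/2) * (s - t)"
      using c \<psi>t that tab by (intro dini) auto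
    moreover have "\<forall>\<^sub>F s in at_right t. t < s \<and> s < b"
      using tab by (simp add: eventually_at_right_less eventually_conj eventually_at_right[of t b] exI[of _ b])
    ultimately have "\<forall>\<^sub>F s in at_right t. False"
    proof eventually_elim
      case (elim s)
      then have "\<psi> s \<le> \<psi> t - (e/2) * (s - t)"
        by (simp add: \<psi>_def field_simps)
      moreover have "(e/2) * (s - t) > 0" using elim that by auto
      ultimately show False using gt[of s] \<psi>t elim by auto
    qed
    then show False by (simp add: trivial_limit_def[symmetric])
  qed
  then have *: "g b - g a \<le> e * (b - a)" if "e > 0" for e
    using that by (force simp: algebra_simps)
  show ?thesis
  proof (rule ccontr)
    assume "\<not> g b \<le> g a"
    then have pos: "g b - g a > 0" by simp
    have "b - a + 1 > 0" using assms(1) by simp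
    then have "g b - g a \<le> (g b - g a) / (b - a + 1) * (b - a)"
      using pos by (intro *) auto
    then have "(g b - g a) * (b - a + 1) \<le> (g b - g a) * (b - a)"
      using \<open>b - a + 1 > 0\<close> by (simp add: field_simps)
    then show False using pos by (simp add: mult_le_cancel_left)
  qed
qed

lemma Dini_nonpos_if_right_derivative_nonpos:
  fixes g :: "real \<Rightarrow> real"
  assumes "(g has_real_derivative d) (at_right t)" "d \<le> 0" "e > 0"
  shows "\<forall>\<^sub>F s in at_right t. g s \<le> g t + e * (s - t)"
proof -
  have lim: "((\<lambda>s. (g s - g t) / (s - t)) \<longlongrightarrow> d) (at_right t)"
    using assms(1) by (simp add: has_field_derivative_iff)
  have "\<forall>\<^sub>F s in at_right t. (g s - g t) / (s - t) < e"
    using assms(2,3) by (intro order_tendstoD(2)[OF lim]) auto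
  then show ?thesis
    using eventually_at_right_less[of t]
    by eventually_elim (auto simp: field_simps)
qed

lemma nonincreasing_if_Lipschitz_ae_deriv_nonpos:
  fixes g :: "real \<Rightarrow> real"
  assumes ab: "0 \<le> a" "a \<le> b" and lip: "L-lipschitz_on {a..b} g"
    and ae: "AE t in lebesgue_on {0..}. \<exists>d\<le>0. (g has_real_derivative d) (at t within {0..})"
  shows "g b \<le> g a"
proof -
  define P where "P t \<longleftrightarrow> (\<exists>d\<le>0. (g has_real_derivative d) (at t within {0..}))" for t
  have "AE t in lebesgue. t \<in> {0..} \<longrightarrow> P t"
    using ae unfolding P_def by (subst (asm) AE_restrict_space_iff) auto
  then obtain Z where Z: "Z \<in> null_sets lebesgue" "{t. \<not> (t \<in> {0..} \<longrightarrow> P t)} \<subseteq> Z"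
    unfolding eventually_ae_filter by auto
  define N where "N = Z \<inter> {a..b}"
  have negN: "negligible N"
    using Z(1) by (auto simp: N_def negligible_iff_null_sets[symmetric] negligible_Int)
  show ?thesis
  proof (rule nonincreasing_if_Dini_nonpos[OF ab(2), where N = N])
    show "continuous_on {a..b} g" using lip lipschitz_on_continuous_on by blast
    show "negligible ((\<lambda>t. g t - e * t) ` N)" if "e > 0" for e
    proof (rule negligible_locally_Lipschitz_image[OF _ negN])
      fix x assume x: "x \<in> N"
      have "norm ((g y - e * y) - (g x - e * x)) \<le> (L + e) * norm (y - x)" if "y \<in> N" for y
      proof -
        have "\<bar>g y - g x\<bar> \<le> L * \<bar>y - x\<bar>"
          using lipschitz_onD[OF lip, of y x] that x by (simp add: N_def dist_real_def)
        moreover have "\<bar>(g y - e * y) - (g x - e * x)\<bar> \<le> \<bar>g y - g x\<bar> + \<bar>e * (y - x)\<bar>"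
          by (simp add: algebra_simps)
        moreover have "\<bar>e * (y - x)\<bar> = e * \<bar>y - x\<bar>"
          using \<open>e > 0\<close> by (simp add: abs_mult)
        ultimately show ?thesis by (simp add: distrib_right)
      qed
      then show "\<exists>T B. open T \<and> x \<in> T \<and>
          (\<forall>y\<in>N \<inter> T. norm ((g y - e * y) - (g x - e * x)) \<le> B * norm (y - x))"
        by (intro exI[of _ UNIV] exI[of _ "L + e"]) auto
    qed simp
    fix t e :: real assume t: "a \<le> t" "t < b" "t \<notin> N" "e > 0"
    then have "t \<notin> Z" "t \<in> {0..}" using ab by (auto simp: N_def)
    then have "P t" using Z(2) by blast
    then obtain d where d: "d \<le> 0" "(g has_real_derivative d) (at t within {0..})"
      by (auto simp: P_def)
    have "(g has_real_derivative d) (at_right t)"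
      by (rule has_field_derivative_subset[OF d(2)]) (use t ab in auto)
    then show "\<forall>\<^sub>F s in at_right t. g s \<le> g t + e * (s - t)"
      using d(1) t(4) by (rule Dini_nonpos_if_right_derivative_nonpos)
  qed
qed

lemma has_real_derivative_norm_square:
  fixes u :: "real \<Rightarrow> 'a::real_inner"
  assumes "(u has_vector_derivative w) (at t within S)"
  shows "((\<lambda>t. (norm (u t))\<^sup>2) has_real_derivative 2 * (w \<bullet> u t)) (at t within S)"
  unfolding power2_norm_eq_inner has_field_derivative_def
  using assms[unfolded has_vector_derivative_def]
  by (auto intro!: derivative_eq_intros simp: inner_commute)

lemma lipschitz_on_norm_square:
  fixes w :: "real \<Rightarrow> 'a::real_inner"
  assumes "L-lipschitz_on S w" "\<And>t. t \<in> S \<Longrightarrow> norm (w t) \<le> B" "B \<ge> 0"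
  shows "(2 * B * L)-lipschitz_on S (\<lambda>t. (norm (w t))\<^sup>2)"
proof (rule lipschitz_onI)
  show "0 \<le> 2 * B * L" using assms(3) lipschitz_on_nonneg[OF assms(1)] by simp
  fix s t assume st: "s \<in> S" "t \<in> S"
  have "\<bar>(norm (w s))\<^sup>2 - (norm (w t))\<^sup>2\<bar> = (norm (w s) + norm (w t)) * \<bar>norm (w s) - norm (w t)\<bar>"
    by (simp add: power2_eq_square square_diff_square_factored abs_mult)
  also have "\<dots> \<le> (B + B) * norm (w s - w t)"
    using assms(2)[OF st(1)] assms(2)[OF st(2)] assms(3) norm_triangle_ineq3
    by (intro mult_mono add_mono) auto
  also have "\<dots> \<le> (B + B) * (L * dist s t)"
    using lipschitz_onD[OF assms(1) st] assms(3) by (intro mult_left_mono) (auto simp: dist_norm)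
  finally show "dist ((norm (w s))\<^sup>2) ((norm (w t))\<^sup>2) \<le> 2 * B * L * dist s t"
    by (simp add: dist_real_def)
qed

section \<open>Maximal monotone operators\<close>

lemma norm_le_if_inner_le:
  fixes d e :: "'a::real_inner"
  assumes "(e - d) \<bullet> d \<ge> 0"
  shows "norm d \<le> norm e"
proof -
  have "norm d * norm d \<le> e \<bullet> d"
    using assms by (simp add: inner_diff_left power2_norm_eq_inner[symmetric] power2_eq_square)
  also have "\<dots> \<le> norm e * norm d" by (rule norm_cauchy_schwarz)
  finally show ?thesis by (cases "d = 0") auto
qed

text \<open>
  The operator is represented by its graph. Maximality is encoded by Minty's range condition, which is the
  form in which it is verified and from which the resolvents are built.
\<close>

locale maximal_monotone =
  fixes A :: "('a::euclidean_space \<times> 'a) set"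
  assumes monotone: "\<lbrakk>(x, v) \<in> A; (y, w) \<in> A\<rbrakk> \<Longrightarrow> (v - w) \<bullet> (x - y) \<ge> 0"
    and surjective: "h > 0 \<Longrightarrow> \<exists>x v. (x, v) \<in> A \<and> x + h *\<^sub>R v = z"
begin

text \<open>
  Minty's argument: solve \<open>x + v = y + w\<close> with \<open>v \<in> A x\<close>. Testing the hypothesis against this very
  pair yields \<open>- |y - x|\<^sup>2 \<ge> 0\<close>.
\<close>

lemma maximal:
  assumes "\<And>x v. (x, v) \<in> A \<Longrightarrow> (w - v) \<bullet> (y - x) \<ge> 0"
  shows "(y, w) \<in> A"
proof -
  obtain x v where xv: "(x, v) \<in> A" "x + v = y + w"
    using surjective[of 1 "y + w"] by auto
  then have eq: "w - v = - (y - x)" by (simp add: algebra_simps)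
  have "(w - v) \<bullet> (y - x) \<ge> 0" using assms xv by blast
  then have "(y - x) \<bullet> (y - x) \<le> 0" unfolding eq inner_minus_left by simp
  then have "(y - x) \<bullet> (y - x) = 0" by (metis inner_ge_zero order_antisym)
  then have "y = x" by simp
  with xv show ?thesis by simp
qed

text \<open>
  By maximality the set of values at a point is an intersection of closed half-spaces. It is therefore closed
  and convex, and if it is nonempty it has a unique element of least norm.
\<close>

lemma values_eq:
  "(y, w) \<in> A \<longleftrightarrow> (\<forall>(x, v) \<in> A. (w - v) \<bullet> (y - x) \<ge> 0)"
  using maximal monotone by blast

lemma closed_values: "closed {w. (y, w) \<in> A}"
proof -
  have "{w. (y, w) \<in> A} = (\<Inter>(x, v)\<in>A. {w. (w - v) \<bullet> (y - x) \<ge> 0})"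
    by (auto simp: values_eq)
  also have "closed \<dots>"
    by (auto intro!: closed_INT closed_Collect_le continuous_intros)
  finally show ?thesis .
qed

lemma convex_values: "convex {w. (y, w) \<in> A}"
proof -
  have "{w. (y, w) \<in> A} = (\<Inter>(x, v)\<in>A. {w. (y - x) \<bullet> w \<ge> (y - x) \<bullet> v})"
    by (auto simp: values_eq inner_diff_left inner_commute)
  also have "convex \<dots>"
    by (auto intro!: convex_INT convex_halfspace_ge)
  finally show ?thesis .
qed

definition minimal_section :: "'a \<Rightarrow> 'a" where
  "minimal_section y = closest_point {w. (y, w) \<in> A} 0"

lemma minimal_section_in: "y \<in> Domain A \<Longrightarrow> (y, minimal_section y) \<in> A"
  using closest_point_in_set[OF closed_values[of y], of 0] by (auto simp: minimal_section_def)

lemma minimal_section_unique: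
  assumes "(y, w) \<in> A" "norm w \<le> norm (minimal_section y)"
  shows "w = minimal_section y"
  unfolding minimal_section_def
proof (rule closest_point_unique[OF convex_values closed_values])
  show "w \<in> {w. (y, w) \<in> A}" using assms by simp
  show "\<forall>z\<in>{w. (y, w) \<in> A}. dist 0 w \<le> dist 0 z"
    using assms(2) closest_point_le[OF closed_values[of y], of _ 0]
    unfolding minimal_section_def by force
qed

section \<open>The implicit Euler scheme and its limit\<close>

text \<open>
  One implicit Euler step with step size \<open>h\<close>, that is the map \<open>(I + hA)\<^sup>-\<^sup>1\<close>.
\<close>

definition resolvent :: "real \<Rightarrow> 'a \<Rightarrow> 'a" where
  "resolvent h z = (SOME x. \<exists>v. (x, v) \<in> A \<and> x + h *\<^sub>R v = z)"

lemma resolvent_in: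
  assumes "h > 0"
  shows "(resolvent h z, (1 / h) *\<^sub>R (z - resolvent h z)) \<in> A"
proof -
  have "\<exists>v. (resolvent h z, v) \<in> A \<and> resolvent h z + h *\<^sub>R v = z"
    unfolding resolvent_def using surjective[OF assms, of z] by (rule someI_ex)
  then obtain v where v: "(resolvent h z, v) \<in> A" "resolvent h z + h *\<^sub>R v = z" by blast
  then have "z - resolvent h z = h *\<^sub>R v" by (metis add_diff_cancel_left')
  then have "(1 / h) *\<^sub>R (z - resolvent h z) = v" using assms by simp
  with v show ?thesis by simp
qed

lemma resolvent_monotone:
  assumes "h > 0" "(y, w) \<in> A"
  shows "(z - resolvent h z - h *\<^sub>R w) \<bullet> (resolvent h z - y) \<ge> 0"
proof -
  have "h * (((1 / h) *\<^sub>R (z - resolvent h z) - w) \<bullet> (resolvent h z - y)) \<ge> 0"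
    using monotone[OF resolvent_in[OF assms(1)] assms(2)] assms(1) by simp
  also have "h * (((1 / h) *\<^sub>R (z - resolvent h z) - w) \<bullet> (resolvent h z - y))
      = (z - resolvent h z - h *\<^sub>R w) \<bullet> (resolvent h z - y)"
    using assms(1) by (simp add: inner_diff_left right_diff_distrib)
  finally show ?thesis .
qed

lemma resolvent_nonexpansive:
  assumes "h > 0"
  shows "norm (resolvent h z - resolvent h z') \<le> norm (z - z')"
proof (rule norm_le_if_inner_le)
  have "(z - resolvent h z - h *\<^sub>R ((1 / h) *\<^sub>R (z' - resolvent h z'))) \<bullet> (resolvent h z - resolvent h z') \<ge> 0"
    by (intro resolvent_monotone resolvent_in assms)
  then show "(z - z' - (resolvent h z - resolvent h z')) \<bullet> (resolvent h z - resolvent h z') \<ge> 0"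
    using assms by (simp add: algebra_simps)
qed

lemma resolvent_step:
  assumes "h > 0" "(x, v) \<in> A"
  shows "norm (resolvent h x - x) \<le> h * norm v"
proof -
  have "norm (resolvent h x - x) \<le> norm (- (h *\<^sub>R v))"
    using resolvent_monotone[OF assms, of x] by (intro norm_le_if_inner_le) (simp add: algebra_simps)
  then show ?thesis using assms(1) by simp
qed

definition euler :: "real \<Rightarrow> nat \<Rightarrow> 'a \<Rightarrow> 'a" where
  "euler h k x = (resolvent h ^^ k) x"

lemma euler_simps [simp]: "euler h 0 x = x" "euler h (Suc k) x = resolvent h (euler h k x)"
  by (simp_all add: euler_def)

text \<open>
  Since the resolvent is nonexpansive, no step is longer than the first one. This a priori bound makes the
  iterates equi-Lipschitz.
\<close>

lemma euler_step:
  assumes "h > 0" "(x, v) \<in> A"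
  shows "norm (euler h (Suc k) x - euler h k x) \<le> h * norm v"
proof (induction k)
  case 0
  show ?case using resolvent_step[OF assms] by simp
next
  case (Suc k)
  then show ?case
    using resolvent_nonexpansive[OF assms(1), of "euler h (Suc k) x" "euler h k x"] by simp
qed

lemma euler_dist:
  assumes "h > 0" "(x, v) \<in> A"
  shows "norm (euler h (j + m) x - euler h j x) \<le> norm v * (h * m)"
proof (induction m)
  case (Suc m)
  have "norm (euler h (j + Suc m) x - euler h j x)
      \<le> norm (euler h (Suc (j + m)) x - euler h (j + m) x) + norm (euler h (j + m) x - euler h j x)"
    using norm_triangle_ineq[of "euler h (Suc (j + m)) x - euler h (j + m) x" "euler h (j + m) x - euler h j x"]
    by simp
  also have "\<dots> \<le> h * norm v + norm v * (h * m)"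
    using euler_step[OF assms, of "j + m"] Suc by linarith
  finally show ?case by (simp add: algebra_simps)
qed simp

text \<open>
  The implicit step is what makes this work: it puts an element of \<open>A\<close> at the \<^emph>\<open>new\<close> point, and monotonicity
  compares that element with \<open>w \<in> A y\<close>. The square of the step length has the favourable sign and is dropped.
\<close>

lemma euler_energy_step:
  assumes "h > 0" "(y, w) \<in> A"
  shows "(norm (euler h (Suc k) x - y))\<^sup>2 - (norm (euler h k x - y))\<^sup>2
    \<le> 2 * h * (w \<bullet> (y - euler h (Suc k) x))"
proof -
  define p q where "p = euler h k x - euler h (Suc k) x" and "q = euler h (Suc k) x - y"
  have "(p - h *\<^sub>R w) \<bullet> q \<ge> 0"
    using resolvent_monotone[OF assms, of "euler h k x"] by (simp add: p_def q_def)
  then have "h * (w \<bullet> q) \<le> p \<bullet> q" by (simp add: inner_diff_left)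
  moreover have "(norm (p + q))\<^sup>2 = p \<bullet> p + 2 * (p \<bullet> q) + (norm q)\<^sup>2"
    by (simp add: power2_norm_eq_inner inner_add_left inner_add_right inner_commute)
  moreover have "p \<bullet> p \<ge> 0" by simp
  moreover have "(norm (euler h k x - y))\<^sup>2 = (norm (p + q))\<^sup>2" "2 * h * (w \<bullet> (y - euler h (Suc k) x)) = - 2 * (h * (w \<bullet> q))"
    by (simp_all add: p_def q_def inner_diff_right right_diff_distrib)
  ultimately show ?thesis unfolding q_def[symmetric] by linarith
qed

text \<open>
  The sum of the single-step estimates. The test term is frozen at the initial iterate, at the price of an error
  quadratic in the elapsed time. This form mentions the curve at two times only, so it passes to pointwise
  limits, and the error vanishes when the inequality is divided by the elapsed time.
\<close>

lemma euler_energy: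
  assumes "h > 0" "(x, v) \<in> A" "(y, w) \<in> A"
  shows "(norm (euler h (j + m) x - y))\<^sup>2 - (norm (euler h j x - y))\<^sup>2
    \<le> 2 * (h * m) * (w \<bullet> (y - euler h j x) + norm w * norm v * (h * m))"
proof (induction m)
  case (Suc m)
  define a b where "a = w \<bullet> (y - euler h j x)" and "b = norm w * norm v"
  have b: "b \<ge> 0" by (simp add: b_def)
  have "w \<bullet> (y - euler h (j + Suc m) x) = a - w \<bullet> (euler h (j + Suc m) x - euler h j x)"
    unfolding a_def by (simp add: inner_diff_right)
  also have "\<dots> \<le> a + norm w * norm (euler h (j + Suc m) x - euler h j x)"
    using Cauchy_Schwarz_ineq2[of w "euler h (j + Suc m) x - euler h j x"] by linarith
  also have "\<dots> \<le> a + norm w * (norm v * (h * Suc m))"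
    by (intro add_left_mono mult_left_mono euler_dist assms) auto
  finally have "w \<bullet> (y - euler h (j + Suc m) x) \<le> a + b * (h * Suc m)" by (simp add: b_def)
  then have "2 * h * (w \<bullet> (y - euler h (j + Suc m) x)) \<le> 2 * h * (a + b * (h * Suc m))"
    using assms(1) by (intro mult_left_mono) auto
  then have "(norm (euler h (j + Suc m) x - y))\<^sup>2 - (norm (euler h j x - y))\<^sup>2
     \<le> 2 * (h * m) * (a + b * (h * m)) + 2 * h * (a + b * (h * Suc m))"
    using euler_energy_step[OF assms(1,3), of "j + m" x] Suc unfolding a_def b_def
    by (simp del: euler_simps)
  also have "\<dots> = 2 * (h * Suc m) * (a + b * (h * Suc m)) - 2 * h * h * m * b"
    by (simp add: algebra_simps)
  also have "\<dots> \<le> 2 * (h * Suc m) * (a + b * (h * Suc m))"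
    using assms(1) b by simp
  finally show ?case unfolding a_def b_def .
qed simp

text \<open>
  The Euler curves lie in a product of balls, which is compact for pointwise convergence. A cluster point
  of the sequence inherits both estimates, because each of them involves the curve at finitely many times.
\<close>

lemma euler_limit:
  assumes "(x, v) \<in> A"
  obtains u where "u 0 = x"
    and "\<And>s t. \<lbrakk>0 \<le> s; s \<le> t\<rbrakk> \<Longrightarrow> norm (u t - u s) \<le> norm v * (t - s)"
    and "\<And>s t y w. \<lbrakk>0 \<le> s; s \<le> t; (y, w) \<in> A\<rbrakk> \<Longrightarrow>
      (norm (u t - y))\<^sup>2 - (norm (u s - y))\<^sup>2
        \<le> 2 * (t - s) * (w \<bullet> (y - u s) + norm w * norm v * (t - s))"
proof -
  \<comment> \<open>\<open>U n\<close> is the piecewise constant Euler curve with step size \<open>h n\<close>\<close>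
  define h where "h n = 1 / real (Suc n)" for n
  define k where "k n t = nat \<lfloor>t / h n\<rfloor>" for n t
  define U where "U n t = euler (h n) (k n t) x" for n t
  have h: "h n > 0" for n by (simp add: h_def)
  have k_le: "h n * k n t \<le> t" if "t \<ge> 0" for n t
  proof -
    have "k n t \<le> t / h n" using that h[of n] by (simp add: k_def)
    then show ?thesis using h[of n] by (simp add: field_simps)
  qed
  have k_ge: "t - h n \<le> h n * k n t" if "t \<ge> 0" for n t
  proof -
    have "t / h n < \<lfloor>t / h n\<rfloor> + 1" by linarith
    then have "t / h n - 1 \<le> k n t" using that h[of n] by (simp add: k_def)
    then show ?thesis using h[of n] by (simp add: field_simps)
  qed
  have h0: "h \<longlonglongrightarrow> 0"
    unfolding h_def by (rule LIMSEQ_inverse_real_of_nat[unfolded inverse_eq_divide])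
  have k_lim: "(\<lambda>n. h n * k n t) \<longlonglongrightarrow> t" if "t \<ge> 0" for t
  proof (rule tendsto_sandwich)
    show "(\<lambda>n. t - h n) \<longlonglongrightarrow> t" using tendsto_diff[OF tendsto_const h0, of t] by simp
  qed (use k_le k_ge that in auto)
  have diff: "k n s + (k n t - k n s) = k n t"
      "h n * real (k n t - k n s) = h n * k n t - h n * k n s" if "0 \<le> s" "s \<le> t" for n s t
  proof -
    have "s / h n \<le> t / h n" using that h[of n] by (simp add: divide_right_mono)
    then have "k n s \<le> k n t" unfolding k_def by (intro nat_mono floor_mono)
    then show "k n s + (k n t - k n s) = k n t"
      "h n * real (k n t - k n s) = h n * k n t - h n * k n s" by (simp_all add: of_nat_diff right_diff_distrib)
  qed
  \<comment> \<open>the absolute value makes room for negative times, where the Euler curve stays at \<open>x\<close>\<close>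
  have "compact (PiE UNIV (\<lambda>t::real. cball x (norm v * \<bar>t\<bar>)))"
    using compactin_PiE[of "\<lambda>_. euclidean" UNIV "\<lambda>t::real. cball x (norm v * \<bar>t\<bar>)"]
    by (simp add: euclidean_product_topology)
  moreover have "U n t \<in> cball x (norm v * \<bar>t\<bar>)" for n t
  proof -
    have "h n * k n t \<le> \<bar>t\<bar>"
      using k_le[of t n] h[of n] by (cases "t \<ge> 0") (auto simp: k_def divide_nonpos_pos)
    then have "norm v * (h n * k n t) \<le> norm v * \<bar>t\<bar>" by (intro mult_left_mono) auto
    then show ?thesis
      using euler_dist[OF h assms, of n 0 "k n t"] by (simp add: U_def dist_norm norm_minus_commute)
  qed
  then have "\<forall>\<^sub>F n in sequentially. U n \<in> PiE UNIV (\<lambda>t. cball x (norm v * \<bar>t\<bar>))"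
    by (intro always_eventually allI) (simp add: PiE_UNIV_domain)
  ultimately obtain G u where G: "G \<le> sequentially" "G \<noteq> bot" "(U \<longlongrightarrow> u) G"
    using compact_cluster[OF _ sequentially_bot] by metis
  have U_lim: "((\<lambda>n. U n t) \<longlongrightarrow> u t) G" for t
    by (rule continuous_on_tendsto_compose[OF continuous_on_product_coordinates G(3)]) auto
  have kG: "((\<lambda>n. h n * k n t) \<longlongrightarrow> t) G" if "t \<ge> 0" for t
    using tendsto_mono[OF G(1) k_lim[OF that]] .
  show ?thesis
  proof
    have "((\<lambda>n. x) \<longlongrightarrow> u 0) G" using U_lim[of 0] by (simp add: U_def k_def)
    then show "u 0 = x" using G(2) by (simp add: tendsto_const_iff)
    fix s t :: real assume st: "0 \<le> s" "s \<le> t"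
    show "norm (u t - u s) \<le> norm v * (t - s)"
    proof (rule tendsto_le[OF G(2)])
      show "((\<lambda>n. norm v * (h n * k n t - h n * k n s)) \<longlongrightarrow> norm v * (t - s)) G"
        using st by (intro tendsto_intros kG) auto
      show "((\<lambda>n. norm (U n t - U n s)) \<longlongrightarrow> norm (u t - u s)) G"
        by (intro tendsto_intros U_lim)
      show "\<forall>\<^sub>F n in G. norm (U n t - U n s) \<le> norm v * (h n * k n t - h n * k n s)"
      proof (intro always_eventually allI)
        fix n
        show "norm (U n t - U n s) \<le> norm v * (h n * k n t - h n * k n s)"
          using euler_dist[OF h assms, of n "k n s" "k n t - k n s"]
          unfolding diff[OF st] U_def .
      qed
    qed
    fix y w assume yw: "(y, w) \<in> A"
    show "(norm (u t - y))\<^sup>2 - (norm (u s - y))\<^sup>2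
        \<le> 2 * (t - s) * (w \<bullet> (y - u s) + norm w * norm v * (t - s))"
    proof (rule tendsto_le[OF G(2)])
      show "((\<lambda>n. 2 * (h n * k n t - h n * k n s) *
          (w \<bullet> (y - U n s) + norm w * norm v * (h n * k n t - h n * k n s)))
        \<longlongrightarrow> 2 * (t - s) * (w \<bullet> (y - u s) + norm w * norm v * (t - s))) G"
        using st by (intro tendsto_intros kG U_lim) auto
      show "((\<lambda>n. (norm (U n t - y))\<^sup>2 - (norm (U n s - y))\<^sup>2)
        \<longlongrightarrow> (norm (u t - y))\<^sup>2 - (norm (u s - y))\<^sup>2) G"
        by (intro tendsto_intros U_lim)
      show "\<forall>\<^sub>F n in G. (norm (U n t - y))\<^sup>2 - (norm (U n s - y))\<^sup>2
        \<le> 2 * (h n * k n t - h n * k n s) *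
          (w \<bullet> (y - U n s) + norm w * norm v * (h n * k n t - h n * k n s))"
      proof (intro always_eventually allI)
        fix n
        show "(norm (U n t - y))\<^sup>2 - (norm (U n s - y))\<^sup>2
          \<le> 2 * (h n * k n t - h n * k n s) *
            (w \<bullet> (y - U n s) + norm w * norm v * (h n * k n t - h n * k n s))"
          using euler_energy[OF h assms yw, of n "k n s" "k n t - k n s"]
          unfolding diff[OF st] U_def .
      qed
    qed
  qed
qed

end

section \<open>Differentiability of the limit curve\<close>

text \<open>
  The properties of the limit of the Euler scheme, isolated. They determine the derivative of the curve.
\<close>

locale energy_trajectory = maximal_monotone A
  for A :: "('a::euclidean_space \<times> 'a) set" +
  fixes u :: "real \<Rightarrow> 'a" and C :: real
  assumes Lipschitz: "\<lbrakk>0 \<le> s; s \<le> t\<rbrakk> \<Longrightarrow> norm (u t - u s) \<le> C * (t - s)"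
    and energy: "\<lbrakk>0 \<le> s; s \<le> t; (y, w) \<in> A\<rbrakk> \<Longrightarrow>
      (norm (u t - y))\<^sup>2 - (norm (u s - y))\<^sup>2
        \<le> 2 * (t - s) * (w \<bullet> (y - u s) + norm w * C * (t - s))"
begin

definition quot :: "real \<Rightarrow> real \<Rightarrow> 'a" where
  "quot s t = (1 / (t - s)) *\<^sub>R (u t - u s)"

lemma quot_commute: "quot s t = quot t s"
proof -
  have "1 / (t - s) = - (1 / (s - t))" by (metis minus_diff_eq divide_minus_right)
  then show ?thesis unfolding quot_def by (simp add: algebra_simps)
qed

lemma norm_quot_le_iff: "s < t \<Longrightarrow> norm (quot s t) \<le> c \<longleftrightarrow> norm (u t - u s) \<le> c * (t - s)"
proof -
  assume "s < t"
  moreover have "norm (quot s t) = norm (u t - u s) / (t - s)"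
    using \<open>s < t\<close> by (simp add: quot_def)
  ultimately show ?thesis by (simp add: pos_divide_le_eq)
qed

lemma norm_quot_le:
  assumes "0 \<le> s" "0 \<le> t"
  shows "norm (quot s t) \<le> C"
proof -
  have *: "norm (quot s t) \<le> C" if "0 \<le> s" "s < t" for s t
    using Lipschitz[of s t] that by (simp add: norm_quot_le_iff)
  have "C \<ge> 0" using order_trans[OF norm_ge_zero Lipschitz[of 0 1]] by simp
  with *[of s t] *[of t s] assms show ?thesis
    by (cases s t rule: linorder_cases) (auto simp: quot_commute quot_def)
qed

lemma C_nonneg: "C \<ge> 0"
  using norm_quot_le[of 0 0] by (simp add: quot_def)

lemma lipschitz: "C-lipschitz_on {0..} u"
proof (rule lipschitz_onI[OF _ C_nonneg])
  fix s t :: real assume "s \<in> {0..}" "t \<in> {0..}"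
  then show "dist (u s) (u t) \<le> C * dist s t"
    using Lipschitz[of s t] Lipschitz[of t s]
    by (cases "s \<le> t") (auto simp: dist_norm norm_minus_commute)
qed

lemma continuous: "continuous_on {0..} u"
  using lipschitz by (rule lipschitz_on_continuous_on)

lemma energy_quot_forward:
  assumes "0 \<le> s" "s < t" "(y, w) \<in> A"
  shows "quot s t \<bullet> ((1/2) *\<^sub>R (u t + u s) - y) \<le> w \<bullet> (y - u s) + norm w * C * (t - s)"
proof -
  define m where "m = (1/2) *\<^sub>R (u t + u s) - y"
  have "(norm (u t - y))\<^sup>2 - (norm (u s - y))\<^sup>2 = 2 * ((u t - u s) \<bullet> m)"
    unfolding m_def power2_norm_eq_inner
    by (simp add: inner_diff_left inner_diff_right inner_add_right inner_commute)
  also have "u t - u s = (t - s) *\<^sub>R quot s t" using assms by (simp add: quot_def)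
  also have "2 * ((t - s) *\<^sub>R quot s t \<bullet> m) = 2 * (t - s) * (quot s t \<bullet> m)" by simp
  finally have "2 * (t - s) * (quot s t \<bullet> m) \<le> 2 * (t - s) * (w \<bullet> (y - u s) + norm w * C * (t - s))"
    using energy[of s t y w] assms by simp
  then show ?thesis unfolding m_def by (rule mult_left_le_imp_le) (use assms in simp)
qed

text \<open>
  For \<open>t < s\<close> the forward inequality has the test term at \<open>t\<close>; moving it to \<open>s\<close> costs a second error of
  the same size. Left and right difference quotients can then be treated alike.
\<close>

lemma energy_quot:
  assumes "0 \<le> s" "0 \<le> t" "s \<noteq> t" "(y, w) \<in> A"
  shows "quot s t \<bullet> ((1/2) *\<^sub>R (u t + u s) - y) \<le> w \<bullet> (y - u s) + 2 * norm w * C * \<bar>t - s\<bar>"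
proof (cases "s < t")
  case True
  have "norm w * C * (t - s) \<ge> 0" using True C_nonneg by simp
  then show ?thesis using energy_quot_forward[of s t y w] assms True by simp
next
  case False
  then have ts: "t < s" using assms(3) by simp
  have "w \<bullet> (y - u t) = w \<bullet> (y - u s) + w \<bullet> (u s - u t)" by (simp add: inner_diff_right)
  also have "w \<bullet> (u s - u t) \<le> norm w * norm (u s - u t)" by (rule norm_cauchy_schwarz)
  also have "\<dots> \<le> norm w * (C * (s - t))"
    using Lipschitz[of t s] ts assms by (intro mult_left_mono) auto
  finally have "w \<bullet> (y - u t) \<le> w \<bullet> (y - u s) + norm w * C * (s - t)" by simp
  then show ?thesis
    using energy_quot_forward[of t s y w] assms ts by (simp add: quot_commute add.commute)
qed

text \<open>
  In the limit the energy inequality says that \<open>- q\<close> is monotonically related to the graph of \<open>A\<close>,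
  so maximality applies.
\<close>

lemma quot_cluster:
  assumes s: "0 \<le> s" and G: "G \<le> at s within {0..}" "G \<noteq> bot" and q: "(quot s \<longlongrightarrow> q) G"
  shows "(u s, - q) \<in> A"
proof (rule maximal)
  fix y w assume yw: "(y, w) \<in> A"
  have t_lim: "((\<lambda>t. t) \<longlongrightarrow> s) G"
    using G(1) tendsto_mono by blast
  have u_lim: "(u \<longlongrightarrow> u s) G"
    using continuous s G(1) tendsto_mono unfolding continuous_on_def by blast
  have "q \<bullet> ((1/2) *\<^sub>R (u s + u s) - y) \<le> w \<bullet> (y - u s) + 2 * norm w * C * \<bar>s - s\<bar>"
  proof (rule tendsto_le[OF G(2)])
    show "((\<lambda>t. w \<bullet> (y - u s) + 2 * norm w * C * \<bar>t - s\<bar>) \<longlongrightarrow>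
        w \<bullet> (y - u s) + 2 * norm w * C * \<bar>s - s\<bar>) G"
      by (intro tendsto_intros t_lim)
    show "((\<lambda>t. quot s t \<bullet> ((1/2) *\<^sub>R (u t + u s) - y)) \<longlongrightarrow> q \<bullet> ((1/2) *\<^sub>R (u s + u s) - y)) G"
      by (intro tendsto_intros u_lim q)
    have "\<forall>\<^sub>F t in at s within {0..}. t \<noteq> s \<and> t \<in> {0..}"
      by (auto simp: eventually_at_filter)
    from filter_leD[OF G(1) this]
    show "\<forall>\<^sub>F t in G. quot s t \<bullet> ((1/2) *\<^sub>R (u t + u s) - y) \<le> w \<bullet> (y - u s) + 2 * norm w * C * \<bar>t - s\<bar>"
      by eventually_elim (use energy_quot[OF s _ _ yw] in auto)
  qed
  moreover have "(1/2) *\<^sub>R (u s + u s) = u s" by (simp add: scaleR_2[symmetric])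
  ultimately have "q \<bullet> (u s - y) + w \<bullet> (u s - y) \<le> 0" by (simp add: inner_diff_right)
  then show "(- q - w) \<bullet> (u s - y) \<ge> 0"
    by (simp add: inner_diff_left)
qed

lemma quot_bounded: "0 \<le> s \<Longrightarrow> F \<le> at s within {0..} \<Longrightarrow> \<forall>\<^sub>F t in F. quot s t \<in> cball 0 C"
  by (rule filter_leD, assumption) (auto simp: eventually_at_filter norm_quot_le)

text \<open>
  The difference quotients are bounded, so they have a cluster point, and its negative is a value of \<open>A\<close>.
\<close>

lemma in_Domain:
  assumes "0 \<le> s"
  shows "u s \<in> Domain A"
proof -
  have le: "at_right s \<le> at s within {0..}" using assms by (intro at_le) auto
  obtain G q where "G \<le> at_right s" "G \<noteq> bot" "(quot s \<longlongrightarrow> q) G"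
    using compact_cluster[OF compact_cball _ quot_bounded[OF assms le]] trivial_limit_at_right_real by blast
  moreover from this have "G \<le> at s within {0..}" using le by (metis order_trans)
  ultimately show ?thesis using quot_cluster[OF assms] by blast
qed

text \<open>
  The value of least norm along the curve; its negative will be the velocity.
\<close>

definition drift :: "real \<Rightarrow> 'a" where "drift s = minimal_section (u s)"

lemma drift_in: "0 \<le> s \<Longrightarrow> (u s, drift s) \<in> A"
  unfolding drift_def by (intro minimal_section_in in_Domain)

text \<open>
  A limit of difference quotients whose norm does not exceed the least one can only be the minimal section.
\<close>

lemma quot_tendsto:
  assumes s: "0 \<le> s" and F: "F \<le> at s within {0..}"
    and b: "\<forall>\<^sub>F t in F. norm (quot s t) \<le> b t" "(b \<longlongrightarrow> norm (drift s)) F"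
  shows "(quot s \<longlongrightarrow> - drift s) F"
proof (rule tendsto_if_unique_cluster[OF compact_cball quot_bounded[OF s F]])
  fix G q assume G: "G \<le> F" "G \<noteq> bot" "(quot s \<longlongrightarrow> q) G"
  have "norm q \<le> norm (drift s)"
    using tendsto_le[OF G(2) tendsto_mono[OF G(1) b(2)] tendsto_norm[OF G(3)]] filter_leD[OF G(1) b(1)]
    by simp
  moreover have "(u s, - q) \<in> A"
    using quot_cluster[OF s _ G(2,3)] G(1) F by simp
  ultimately have "- q = drift s"
    using minimal_section_unique[of "u s" "- q"] by (simp add: drift_def)
  then show "q = - drift s" by (metis minus_minus)
qed

text \<open>
  Testing the energy inequality at \<open>y = u s\<close> bounds the growth rate of \<open>|u - u s|\<^sup>2\<close> at time \<open>r\<close> by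
  \<open>2 |drift s| |u r - u s|\<close>. Inserting the assumed bound \<open>D (r - s)\<close> and integrating gives the claim.
\<close>

lemma square_growth:
  assumes s: "0 \<le> s" and t: "s \<le> t" and D: "\<And>r. s \<le> r \<Longrightarrow> norm (u r - u s) \<le> D * (r - s)"
  shows "(norm (u t - u s))\<^sup>2 \<le> norm (drift s) * D * (t - s)\<^sup>2"
proof -
  define a where "a = norm (drift s)"
  define g where "g r = (norm (u r - u s))\<^sup>2 - a * D * (r - s)\<^sup>2" for r
  have "g t \<le> g s"
  proof (rule nonincreasing_if_Dini_nonpos[OF t, where N = "{}"])
    show "continuous_on {s..t} g"
      unfolding g_def[abs_def] using s
      by (intro continuous_intros continuous_on_subset[OF continuous]) auto
    fix r e :: real assume r: "s \<le> r" "r < t" "e > 0"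
    \<comment> \<open>\<open>b\<close> collects the terms quadratic in the time increment\<close>
    define b where "b = 2 * a * C - a * D"
    have bound: "g r' - g r \<le> (r' - r) * (b * (r' - r))" if "r < r'" for r'
    proof -
      have "drift s \<bullet> (u s - u r) \<le> a * norm (u s - u r)"
        unfolding a_def by (rule norm_cauchy_schwarz)
      also have "\<dots> \<le> a * (D * (r - s))"
        using D[OF r(1)] by (intro mult_left_mono) (auto simp: a_def norm_minus_commute)
      finally have "2 * (r' - r) * (drift s \<bullet> (u s - u r) + a * C * (r' - r))
          \<le> 2 * (r' - r) * (a * (D * (r - s)) + a * C * (r' - r))"
        using that by (intro mult_left_mono) auto
      moreover have "(norm (u r' - u s))\<^sup>2 - (norm (u r - u s))\<^sup>2
          \<le> 2 * (r' - r) * (drift s \<bullet> (u s - u r) + a * C * (r' - r))"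
        using energy[OF _ _ drift_in[OF s], of r r'] s r that by (simp add: a_def)
      ultimately have "(norm (u r' - u s))\<^sup>2 - (norm (u r - u s))\<^sup>2
          \<le> 2 * (r' - r) * (a * (D * (r - s)) + a * C * (r' - r))" by linarith
      then show ?thesis
        unfolding g_def b_def by (simp add: power2_eq_square algebra_simps)
    qed
    have "((\<lambda>r'. b * (r' - r)) \<longlongrightarrow> b * (r - r)) (at_right r)" by (intro tendsto_intros)
    then have "\<forall>\<^sub>F r' in at_right r. b * (r' - r) < e"
      using r(3) by (intro order_tendstoD(2)[of _ "b * (r - r)"]) auto
    then show "\<forall>\<^sub>F r' in at_right r. g r' \<le> g r + e * (r' - r)"
      using eventually_at_right_less[of r]
    proof eventually_elim
      case (elim r')
      then have "(r' - r) * (b * (r' - r)) \<le> (r' - r) * e" by (intro mult_left_mono) auto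
      then show ?case using bound[OF elim(2)] unfolding mult.commute[of e] by linarith
    qed
  qed simp
  then show ?thesis by (simp add: g_def a_def)
qed

text \<open>
  Let \<open>D\<close> be the best Lipschitz constant at \<open>s\<close> for later times. The preceding lemma improves it to
  the square root of \<open>|drift s| D\<close>; hence \<open>D\<^sup>2 \<le> |drift s| D\<close>.
\<close>

lemma sharp_Lipschitz:
  assumes s: "0 \<le> s" and t: "s \<le> t"
  shows "norm (u t - u s) \<le> norm (drift s) * (t - s)"
proof -
  define D where "D = (SUP r\<in>{s<..}. norm (quot s r))"
  have bdd: "bdd_above ((\<lambda>r. norm (quot s r)) ` {s<..})"
    using norm_quot_le s by (intro bdd_aboveI[of _ C]) auto
  have quotD: "norm (quot s r) \<le> D" if "s < r" for r
    unfolding D_def using that by (intro cSUP_upper bdd) auto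
  have eq: "norm (u r - u s) = norm (quot s r) * (r - s)" if "s < r" for r
    using that by (simp add: quot_def)
  have D: "norm (u r - u s) \<le> D * (r - s)" if "s \<le> r" for r
    using quotD[of r] eq[of r] that by (cases "s = r") (auto intro: mult_right_mono)
  have D0: "D \<ge> 0" using order_trans[OF norm_ge_zero quotD[of "s + 1"]] by simp
  have "norm (quot s r) \<le> sqrt (norm (drift s) * D)" if "s < r" for r
  proof (rule real_le_rsqrt)
    have "(norm (quot s r))\<^sup>2 * (r - s)\<^sup>2 \<le> norm (drift s) * D * (r - s)\<^sup>2"
      using square_growth[OF s _ D, of r] that eq[OF that] by (simp add: power_mult_distrib)
    then show "(norm (quot s r))\<^sup>2 \<le> norm (drift s) * D" using that by simp
  qed
  then have "D \<le> sqrt (norm (drift s) * D)"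
    unfolding D_def by (intro cSUP_least) auto
  then have "D\<^sup>2 \<le> (sqrt (norm (drift s) * D))\<^sup>2" using D0 by (rule power_mono)
  then have "D * D \<le> norm (drift s) * D" using D0 by (simp add: power2_eq_square)
  then have "D \<le> norm (drift s)" using D0 by (cases "D = 0") auto
  then have "D * (t - s) \<le> norm (drift s) * (t - s)" using t by (intro mult_right_mono) auto
  then show ?thesis using D[OF t] by simp
qed

lemma norm_quot_le_drift:
  assumes "0 \<le> s" "s < t"
  shows "norm (quot s t) \<le> norm (drift s)"
  using sharp_Lipschitz[of s t] assms by (simp add: norm_quot_le_iff)

lemma has_vector_derivative_iff_quot:
  "(u has_vector_derivative w) (at s within S) \<longleftrightarrow> (quot s \<longlongrightarrow> w) (at s within S)"
proof -
  have "(u has_vector_derivative w) (at s within S) \<longleftrightarrow>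
      ((\<lambda>t. (1 / norm (t - s)) *\<^sub>R (u t - (u s + (t - s) *\<^sub>R w))) \<longlongrightarrow> 0) (at s within S)"
    unfolding has_vector_derivative_def has_derivative_within by (simp add: bounded_linear_scaleR_left)
  also have "\<dots> \<longleftrightarrow> ((\<lambda>t. norm (quot s t - w)) \<longlongrightarrow> 0) (at s within S)"
  proof (subst tendsto_norm_zero_iff[symmetric], rule Lim_cong_within)
    fix t assume "t \<noteq> s"
    then have "quot s t - w = (1 / (t - s)) *\<^sub>R (u t - (u s + (t - s) *\<^sub>R w))"
      unfolding quot_def diff_diff_eq[symmetric] scaleR_right_diff_distrib by simp
    then show "norm ((1 / norm (t - s)) *\<^sub>R (u t - (u s + (t - s) *\<^sub>R w))) = norm (quot s t - w)"
      by simp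
  qed simp_all
  also have "\<dots> \<longleftrightarrow> (quot s \<longlongrightarrow> w) (at s within S)"
    by (simp add: tendsto_norm_zero_iff LIM_zero_iff)
  finally show ?thesis .
qed

lemma right_derivative:
  assumes "0 \<le> s"
  shows "(u has_vector_derivative - drift s) (at_right s)"
  unfolding has_vector_derivative_iff_quot
proof (rule quot_tendsto[OF assms, where b = "\<lambda>_. norm (drift s)"])
  show "at_right s \<le> at s within {0..}" using assms by (intro at_le) auto
  show "\<forall>\<^sub>F t in at_right s. norm (quot s t) \<le> norm (drift s)"
    using eventually_at_right_less[of s] by eventually_elim (use norm_quot_le_drift assms in auto)
qed simp

text \<open>
  The curve and its translate by \<open>h\<close> both have right derivatives \<open>- drift\<close> at every time, so monotonicity makes
  the right derivative of their squared distance nonpositive.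
\<close>

lemma shift_contraction:
  assumes "0 \<le> h" "0 \<le> s" "s \<le> t"
  shows "norm (u (t + h) - u t) \<le> norm (u (s + h) - u s)"
proof -
  define w where "w r = u (r + h) - u r" for r
  have "(norm (w t))\<^sup>2 \<le> (norm (w s))\<^sup>2"
  proof (rule nonincreasing_if_Dini_nonpos[OF assms(3), where N = "{}"])
    show "continuous_on {s..t} (\<lambda>r. (norm (w r))\<^sup>2)"
      unfolding w_def using assms
      by (intro continuous_intros continuous_on_compose2[OF continuous]) auto
    fix r e :: real assume r: "s \<le> r" "r < t" "e > 0"
    have im: "(\<lambda>r. r + h) ` {r<..} = {r + h<..}"
    proof safe
      fix x assume "r + h < x"
      then show "x \<in> (\<lambda>r. r + h) ` {r<..}" by (intro image_eqI[of _ _ "x - h"]) auto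
    qed simp
    have "((\<lambda>r. r + h) has_vector_derivative 1) (at_right r)"
      by (auto intro!: derivative_eq_intros)
    then have "((\<lambda>r. u (r + h)) has_vector_derivative - drift (r + h)) (at_right r)"
      using vector_diff_chain_within[of "\<lambda>r. r + h" 1 r "{r<..}" u "- drift (r + h)"]
        right_derivative[of "r + h"] assms r by (simp add: im o_def)
    then have "(w has_vector_derivative (- drift (r + h) - - drift r)) (at_right r)"
      unfolding w_def[abs_def] using right_derivative[of r] r assms
      by (intro has_vector_derivative_diff) auto
    then have "((\<lambda>r. (norm (w r))\<^sup>2) has_real_derivative
        2 * ((- drift (r + h) - - drift r) \<bullet> w r)) (at_right r)"
      by (rule has_real_derivative_norm_square)
    moreover have "2 * ((- drift (r + h) - - drift r) \<bullet> w r) \<le> 0"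
      using monotone[OF drift_in drift_in, of "r + h" r] r assms
      by (simp add: w_def inner_diff_left)
    ultimately show "\<forall>\<^sub>F r' in at_right r. (norm (w r'))\<^sup>2 \<le> (norm (w r))\<^sup>2 + e * (r' - r)"
      using r(3) by (rule Dini_nonpos_if_right_derivative_nonpos)
  qed simp
  then show ?thesis by (simp add: w_def)
qed

text \<open>
  By contraction, later increments are dominated by those starting at \<open>s\<close>, which the sharp Lipschitz estimate
  bounds by \<open>|drift s|\<close>.
\<close>

lemma drift_antimono:
  assumes "0 \<le> s" "s \<le> t"
  shows "norm (drift t) \<le> norm (drift s)"
proof -
  have "((\<lambda>r. norm (quot t r)) \<longlongrightarrow> norm (- drift t)) (at_right t)"
    using right_derivative[of t] assms
    unfolding has_vector_derivative_iff_quot by (intro tendsto_norm) auto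
  moreover have "\<forall>\<^sub>F r in at_right t. norm (quot t r) \<le> norm (drift s)"
    using eventually_at_right_less[of t]
  proof eventually_elim
    case (elim r)
    have "norm (u r - u t) \<le> norm (u (s + (r - t)) - u s)"
      using shift_contraction[of "r - t" s t] elim assms by simp
    also have "\<dots> \<le> norm (drift s) * (r - t)"
      using sharp_Lipschitz[of s "s + (r - t)"] elim assms by simp
    finally show ?case using elim by (simp add: norm_quot_le_iff)
  qed
  ultimately have "norm (- drift t) \<le> norm (drift s)"
    by (intro tendsto_upperbound[of _ _ "at_right t"]) auto
  then show ?thesis by simp
qed

text \<open>
  A quotient to the left of \<open>s\<close> is bounded by the norm of the drift at the earlier time. Continuity of that norm
  at \<open>s\<close> lets this bound tend to \<open>|drift s|\<close>.
\<close>

lemma has_vector_derivative_if_drift_continuous: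
  assumes s: "0 \<le> s" and cont: "continuous (at s within {0..}) (\<lambda>t. norm (drift t))"
  shows "(u has_vector_derivative - drift s) (at s within {0..})"
  unfolding has_vector_derivative_iff_quot
proof (rule quot_tendsto[OF s order_refl, where b = "\<lambda>t. max (norm (drift t)) (norm (drift s))"])
  have "((\<lambda>t. max (norm (drift t)) (norm (drift s))) \<longlongrightarrow> max (norm (drift s)) (norm (drift s)))
      (at s within {0..})"
    by (rule tendsto_max[OF cont[unfolded continuous_within] tendsto_const])
  then show "((\<lambda>t. max (norm (drift t)) (norm (drift s))) \<longlongrightarrow> norm (drift s)) (at s within {0..})"
    by simp
  have "norm (quot s t) \<le> max (norm (drift t)) (norm (drift s))" if "t \<noteq> s" "0 \<le> t" for t
    using norm_quot_le_drift[of s t] norm_quot_le_drift[of t s] that s quot_commute[of s t]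
    by (cases "s < t") (auto simp: le_max_iff_disj)
  then show "\<forall>\<^sub>F t in at s within {0..}. norm (quot s t) \<le> max (norm (drift t)) (norm (drift s))"
    by (auto simp: eventually_at_filter)
qed

lemma countable_drift_discontinuities:
  "countable {s \<in> {0..}. \<not> continuous (at s within {0..}) (\<lambda>t. norm (drift t))}"
proof -
  have "countable {s \<in> {0..}. \<not> continuous (at s within {0..}) (\<lambda>t. - norm (drift t))}"
    by (rule mono_on_ctble_discont) (auto simp: mono_on_def intro: drift_antimono)
  moreover have "continuous (at s within {0..}) (\<lambda>t. - norm (drift t)) \<longleftrightarrow>
      continuous (at s within {0..}) (\<lambda>t. norm (drift t))" for s
    using continuous_minus[of "at s within {0..}" "\<lambda>t. - norm (drift t)"]
      continuous_minus[of "at s within {0..}" "\<lambda>t. norm (drift t)"] by auto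
  ultimately show ?thesis by simp
qed

lemma ae_derivative:
  "AE t in lebesgue_on {0..}. (u has_vector_derivative - drift t) (at t within {0..})"
proof -
  let ?N = "{s \<in> {0..}. \<not> continuous (at s within {0..}) (\<lambda>t. norm (drift t))}"
  have "?N \<in> null_sets lebesgue"
    by (intro null_sets_completionI countable_imp_null_set_lborel countable_drift_discontinuities)
  then have "AE t in lebesgue. t \<notin> ?N" by (rule AE_not_in)
  then have "AE t in lebesgue. t \<in> {0..} \<longrightarrow> (u has_vector_derivative - drift t) (at t within {0..})"
    by eventually_elim (use has_vector_derivative_if_drift_continuous in auto)
  then show ?thesis by (subst AE_restrict_space_iff) auto
qed

end

section \<open>Limits and averages at infinity\<close>

lemma nonincreasing_bounded_below_tendsto:
  fixes f :: "real \<Rightarrow> real"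
  assumes mono: "\<And>s t. \<lbrakk>0 \<le> s; s \<le> t\<rbrakk> \<Longrightarrow> f t \<le> f s" and bound: "\<And>t. 0 \<le> t \<Longrightarrow> f t \<ge> m"
  obtains l where "(f \<longlongrightarrow> l) at_top"
proof -
  define l where "l = (INF t\<in>{0..}. f t)"
  have bdd: "bdd_below (f ` {0..})" using bound by (intro bdd_belowI[of _ m]) auto
  have "(f \<longlongrightarrow> l) at_top"
  proof (rule order_tendstoI)
    fix a assume "a < l"
    have "a < f t" if "t \<ge> 0" for t
      using cINF_lower[OF bdd, of t] that \<open>a < l\<close> unfolding l_def by simp
    then show "\<forall>\<^sub>F t in at_top. a < f t"
      using eventually_ge_at_top[of 0] by (rule eventually_mono[rotated])
  next
    fix a assume "l < a"
    then obtain s where s: "s \<ge> 0" "f s < a"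
      using cINF_less_iff[OF _ bdd, of a] unfolding l_def by auto
    show "\<forall>\<^sub>F t in at_top. f t < a"
      using eventually_ge_at_top[of s] by eventually_elim (use mono s in fastforce)
  qed
  then show ?thesis by (rule that)
qed

lemma has_vector_derivative_integral_atLeast:
  fixes u :: "real \<Rightarrow> 'a::banach"
  assumes "continuous_on {0..} u" "0 \<le> t"
  shows "((\<lambda>t. integral {0..t} u) has_vector_derivative u t) (at t within {0..})"
proof -
  have "((\<lambda>t. integral {0..t} u) has_vector_derivative u t) (at t within {0..t+1})"
    using assms by (intro integral_has_vector_derivative continuous_on_subset[OF assms(1)]) auto
  also have "at t within {0..t+1} = at t within {0..}"
    by (rule at_within_nhd[of t "{..<t+1}"]) auto
  finally show ?thesis .
qed

text \<open>
  Cesaro convergence, by l'Hospital's rule applied to the integral over \<open>t\<close>.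
\<close>

lemma average_tendsto:
  fixes u :: "real \<Rightarrow> 'a::euclidean_space"
  assumes u: "continuous_on {0..} u" and lim: "((\<lambda>t. u t \<bullet> z) \<longlongrightarrow> c) at_top"
  shows "((\<lambda>t. ((1 / t) *\<^sub>R integral {0..t} u) \<bullet> z) \<longlongrightarrow> c) at_top"
proof -
  have "((\<lambda>t. (integral {0..t} u \<bullet> z) / t) \<longlongrightarrow> c) at_top"
  proof (rule lhospital_at_top_at_top[where f' = "\<lambda>t. u t \<bullet> z" and g' = "\<lambda>_. 1"])
    show "\<forall>\<^sub>F t in at_top. ((\<lambda>t. integral {0..t} u \<bullet> z) has_real_derivative u t \<bullet> z) (at t)"
      using eventually_gt_at_top[of 0]
    proof eventually_elim
      case (elim t)
      have "((\<lambda>t. integral {0..t} u) has_vector_derivative u t) (at t within {0..})"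
        using elim by (intro has_vector_derivative_integral_atLeast u) auto
      also have "at t within {0..} = at t"
        using elim by (intro at_within_interior) auto
      finally show ?case
        unfolding has_vector_derivative_def has_field_derivative_def
        by (auto intro!: derivative_eq_intros simp: mult.commute)
    qed
  qed (use lim in \<open>auto intro!: derivative_eq_intros filterlim_ident\<close>)
  then show ?thesis by simp
qed

section \<open>Solutions: existence, contraction, ergodic theorem\<close>

context maximal_monotone
begin

definition solution :: "(real \<Rightarrow> 'a) \<Rightarrow> bool" where
  "solution u \<longleftrightarrow> (\<exists>L. L-lipschitz_on {0..} u) \<and>
     (AE t in lebesgue_on {0..}. \<exists>w. (u has_vector_derivative w) (at t within {0..}) \<and> (u t, - w) \<in> A)"

theorem solution_exists:
  assumes "x \<in> Domain A"
  obtains u where "solution u" "u 0 = x" "\<And>t. 0 \<le> t \<Longrightarrow> u t \<in> Domain A"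
proof -
  from assms obtain v where xv: "(x, v) \<in> A" by blast
  obtain u where u: "u 0 = x"
    "\<And>s t. \<lbrakk>0 \<le> s; s \<le> t\<rbrakk> \<Longrightarrow> norm (u t - u s) \<le> norm v * (t - s)"
    "\<And>s t y w. \<lbrakk>0 \<le> s; s \<le> t; (y, w) \<in> A\<rbrakk> \<Longrightarrow>
      (norm (u t - y))\<^sup>2 - (norm (u s - y))\<^sup>2
        \<le> 2 * (t - s) * (w \<bullet> (y - u s) + norm w * norm v * (t - s))"
    using euler_limit[OF xv] by blast
  interpret energy_trajectory A u "norm v"
    by unfold_locales (use u in auto)
  have "solution u"
    unfolding solution_def
  proof
    show "\<exists>L. L-lipschitz_on {0..} u" using lipschitz by blast
    have "AE t in lebesgue_on {0..}. t \<in> {0..}" using AE_space[of "lebesgue_on {0..}"] by simp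
    with ae_derivative show "AE t in lebesgue_on {0..}. \<exists>w. (u has_vector_derivative w) (at t within {0..}) \<and> (u t, - w) \<in> A"
      by eventually_elim (use drift_in in force)
  qed
  then show ?thesis using that u(1) in_Domain by blast
qed

lemma solution_continuous: "solution u \<Longrightarrow> continuous_on {0..} u"
  unfolding solution_def using lipschitz_on_continuous_on by blast

theorem solution_contraction:
  assumes "solution u" "solution v" and st: "0 \<le> s" "s \<le> t"
  shows "norm (u t - v t) \<le> norm (u s - v s)"
proof -
  define w where "w r = u r - v r" for r
  obtain K L where "K-lipschitz_on {0..} u" "L-lipschitz_on {0..} v"
    using assms(1,2) by (auto simp: solution_def)
  then have "(K + L)-lipschitz_on {0..} w"
    unfolding w_def[abs_def] by (rule lipschitz_on_diff)
  then have lip: "(K + L)-lipschitz_on {s..t} w"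
    by (rule lipschitz_on_subset) (use st in auto)
  have "bounded (w ` {s..t})"
    by (intro compact_imp_bounded compact_continuous_image lipschitz_on_continuous_on[OF lip] compact_Icc)
  then obtain B where B: "B > 0" "\<And>r. r \<in> {s..t} \<Longrightarrow> norm (w r) \<le> B"
    unfolding bounded_pos by auto
  have "(norm (w t))\<^sup>2 \<le> (norm (w s))\<^sup>2"
  proof (rule nonincreasing_if_Lipschitz_ae_deriv_nonpos[OF st])
    show "(2 * B * (K + L))-lipschitz_on {s..t} (\<lambda>r. (norm (w r))\<^sup>2)"
      using B by (intro lipschitz_on_norm_square lip) auto
    have "AE r in lebesgue_on {0..}. \<exists>a. (u has_vector_derivative a) (at r within {0..}) \<and> (u r, - a) \<in> A"
      "AE r in lebesgue_on {0..}. \<exists>b. (v has_vector_derivative b) (at r within {0..}) \<and> (v r, - b) \<in> A"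
      using assms(1,2) by (auto simp: solution_def)
    then show "AE r in lebesgue_on {0..}.
        \<exists>d\<le>0. ((\<lambda>r. (norm (w r))\<^sup>2) has_real_derivative d) (at r within {0..})"
    proof eventually_elim
      case (elim r)
      then obtain a b where ab: "(u has_vector_derivative a) (at r within {0..})" "(u r, - a) \<in> A"
        "(v has_vector_derivative b) (at r within {0..})" "(v r, - b) \<in> A" by blast
      then have "(w has_vector_derivative (a - b)) (at r within {0..})"
        unfolding w_def[abs_def] by (intro has_vector_derivative_diff)
      then have "((\<lambda>r. (norm (w r))\<^sup>2) has_real_derivative 2 * ((a - b) \<bullet> w r)) (at r within {0..})"
        by (rule has_real_derivative_norm_square)
      moreover have "2 * ((a - b) \<bullet> w r) \<le> 0"
        using monotone[OF ab(2,4)] by (simp add: w_def inner_diff_left)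
      ultimately show ?case by blast
    qed
  qed
  then show ?thesis by (simp add: w_def)
qed

lemma solution_constant:
  assumes "(y, 0) \<in> A"
  shows "solution (\<lambda>_. y)"
  unfolding solution_def
proof
  have "0-lipschitz_on {0..} (\<lambda>_. y)" by (rule lipschitz_onI) auto
  then show "\<exists>L. L-lipschitz_on {0..} (\<lambda>_. y)" by blast
  show "AE t in lebesgue_on {0..}.
      \<exists>w. ((\<lambda>_. y) has_vector_derivative w) (at t within {0..}) \<and> (y, - w) \<in> A"
    using assms by (intro AE_I2 exI[of _ 0]) auto
qed

text \<open>
  The energy inequality in integrated form: the difference of the two sides is Lipschitz in \<open>T\<close> and, by monotonicity,
  has a nonpositive derivative almost everywhere.
\<close>

lemma solution_energy_integral:
  assumes u: "solution u" and B: "\<And>t. 0 \<le> t \<Longrightarrow> norm (u t) \<le> B"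
    and yw: "(y, w) \<in> A" and T: "0 \<le> T"
  shows "(norm (u T - y))\<^sup>2 - (norm (u 0 - y))\<^sup>2 \<le> 2 * (w \<bullet> (T *\<^sub>R y - integral {0..T} u))"
proof -
  define e where "e t = (norm (u t - y))\<^sup>2" for t
  define m where "m t = 2 * (w \<bullet> (t *\<^sub>R y - integral {0..t} u))" for t
  define M where "M = 2 * (norm w * (norm y + B))"
  have B0: "B \<ge> 0" using B[of 0] norm_ge_zero order_trans by blast
  have m_deriv: "(m has_real_derivative 2 * (w \<bullet> (y - u t))) (at t within {0..})" if "0 \<le> t" for t
    using has_vector_derivative_integral_atLeast[OF solution_continuous[OF u] that]
    unfolding m_def[abs_def] has_vector_derivative_def has_field_derivative_def
    by (auto intro!: derivative_eq_intros simp: algebra_simps inner_diff_right)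
  have m_deriv_le: "norm (2 * (w \<bullet> (y - u t))) \<le> M" if "0 \<le> t" for t
  proof -
    have "\<bar>w \<bullet> (y - u t)\<bar> \<le> norm w * norm (y - u t)" by (rule Cauchy_Schwarz_ineq2)
    also have "\<dots> \<le> norm w * (norm y + B)"
      using norm_triangle_ineq4[of y "u t"] B[OF that] by (intro mult_left_mono) auto
    finally show ?thesis by (simp add: M_def abs_mult)
  qed
  have m_lip: "M-lipschitz_on {0..} m"
  proof (rule lipschitz_onI)
    show "0 \<le> M" using B0 by (simp add: M_def)
    fix s t :: real assume "s \<in> {0..}" "t \<in> {0..}"
    then show "dist (m s) (m t) \<le> M * dist s t"
      using field_differentiable_bound[of "{0..}" m "\<lambda>t. 2 * (w \<bullet> (y - u t))" M s t] m_deriv m_deriv_le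
      by (simp add: dist_norm)
  qed
  obtain L where "L-lipschitz_on {0..} u" using u by (auto simp: solution_def)
  then have "(L + 0)-lipschitz_on {0..} (\<lambda>t. u t - y)"
    by (intro lipschitz_on_diff) (auto intro: lipschitz_onI)
  moreover have "norm (u t - y) \<le> B + norm y" if "0 \<le> t" for t
    using norm_triangle_ineq4[of "u t" y] B[OF that] by simp
  ultimately have "(2 * (B + norm y) * (L + 0))-lipschitz_on {0..} e"
    unfolding e_def[abs_def] using B0 by (intro lipschitz_on_norm_square) auto
  then have lip: "(2 * (B + norm y) * (L + 0) + M)-lipschitz_on {0..} (\<lambda>t. e t - m t)"
    using m_lip by (rule lipschitz_on_diff)
  have "e T - m T \<le> e 0 - m 0"
  proof (rule nonincreasing_if_Lipschitz_ae_deriv_nonpos[OF order_refl T])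
    show "(2 * (B + norm y) * (L + 0) + M)-lipschitz_on {0..T} (\<lambda>t. e t - m t)"
      by (rule lipschitz_on_subset[OF lip]) auto
    have "AE t in lebesgue_on {0..}. \<exists>a. (u has_vector_derivative a) (at t within {0..}) \<and> (u t, - a) \<in> A"
      using u by (auto simp: solution_def)
    moreover have "AE t in lebesgue_on {0..}. t \<in> {0..}"
      using AE_space[of "lebesgue_on {0..}"] by simp
    ultimately show "AE t in lebesgue_on {0..}.
        \<exists>d\<le>0. ((\<lambda>t. e t - m t) has_real_derivative d) (at t within {0..})"
    proof eventually_elim
      case (elim t)
      then obtain a where a: "(u has_vector_derivative a) (at t within {0..})" "(u t, - a) \<in> A" by blast
      have "((\<lambda>t. u t - y) has_vector_derivative (a - 0)) (at t within {0..})"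
        by (intro has_vector_derivative_diff a has_vector_derivative_const)
      then have "(e has_real_derivative 2 * ((a - 0) \<bullet> (u t - y))) (at t within {0..})"
        unfolding e_def[abs_def] by (rule has_real_derivative_norm_square)
      then have "((\<lambda>t. e t - m t) has_real_derivative
          2 * ((a - 0) \<bullet> (u t - y)) - 2 * (w \<bullet> (y - u t))) (at t within {0..})"
        using elim by (intro DERIV_diff m_deriv) auto
      moreover have "2 * ((a - 0) \<bullet> (u t - y)) - 2 * (w \<bullet> (y - u t)) \<le> 0"
        using monotone[OF a(2) yw] by (simp add: inner_diff_left inner_diff_right)
      ultimately show ?case by blast
    qed
  qed
  then show ?thesis by (simp add: e_def m_def)
qed

text \<open>
  Baillon's ergodic theorem, with Opial's argument for uniqueness of the cluster point: zeros \<open>p\<close> and \<open>q\<close> are both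
  constant solutions, so \<open>|u - p|\<close> and \<open>|u - q|\<close> converge, and with them \<open>u \<bullet> (p - q)\<close>.
\<close>

theorem solution_average_tendsto:
  assumes u: "solution u" and bdd: "bounded (u ` {0..})"
  obtains x where "(x, 0) \<in> A" "((\<lambda>t. (1 / t) *\<^sub>R integral {0..t} u) \<longlongrightarrow> x) at_top"
proof -
  define avg where "avg t = (1 / t) *\<^sub>R integral {0..t} u" for t
  obtain B where B: "\<And>t. 0 \<le> t \<Longrightarrow> norm (u t) \<le> B"
    using bdd unfolding bounded_iff by auto
  note cont = solution_continuous[OF u]
  have "avg t \<in> cball 0 B" if "t > 0" for t
  proof -
    have "norm (integral {0..t} u) \<le> B * (t - 0)"
      using that B by (intro integral_bound continuous_on_subset[OF cont]) auto
    then show ?thesis using that by (simp add: avg_def field_simps)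
  qed
  then have avg_bdd: "\<forall>\<^sub>F t in at_top. avg t \<in> cball 0 B"
    using eventually_gt_at_top[of 0] by (rule eventually_mono[rotated])
  have zero: "(p, 0) \<in> A" if G: "G \<le> at_top" "G \<noteq> bot" "(avg \<longlongrightarrow> p) G" for G p
  proof (rule maximal)
    fix y w assume yw: "(y, w) \<in> A"
    have "- (norm (u 0 - y))\<^sup>2 * 0 \<le> 2 * (w \<bullet> (y - p))"
    proof (rule tendsto_le[OF G(2)])
      show "((\<lambda>t. 2 * (w \<bullet> (y - avg t))) \<longlongrightarrow> 2 * (w \<bullet> (y - p))) G"
        by (intro tendsto_intros G(3))
      have "((\<lambda>t. 1 / t) \<longlongrightarrow> 0) G"
        by (rule tendsto_mono[OF G(1)]) (simp add: divide_inverse tendsto_inverse_0_at_top filterlim_ident)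
      then show "((\<lambda>t. - (norm (u 0 - y))\<^sup>2 * (1 / t)) \<longlongrightarrow> - (norm (u 0 - y))\<^sup>2 * 0) G"
        by (intro tendsto_intros)
      have "- (norm (u 0 - y))\<^sup>2 * (1 / t) \<le> 2 * (w \<bullet> (y - avg t))" if t: "t > 0" for t
      proof -
        have "integral {0..t} u = t *\<^sub>R avg t" using t by (simp add: avg_def)
        then have "(norm (u t - y))\<^sup>2 - (norm (u 0 - y))\<^sup>2 \<le> 2 * (w \<bullet> (t *\<^sub>R y - t *\<^sub>R avg t))"
          using solution_energy_integral[OF u B yw, of t] t by simp
        then have "- (norm (u 0 - y))\<^sup>2 \<le> 2 * (w \<bullet> (t *\<^sub>R y - t *\<^sub>R avg t))"
          using zero_le_power2[of "norm (u t - y)"] by linarith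
        also have "\<dots> = t * (2 * (w \<bullet> (y - avg t)))"
          by (simp add: inner_diff_right algebra_simps)
        finally show ?thesis using t by (simp add: field_simps)
      qed
      then have "\<forall>\<^sub>F t in at_top. - (norm (u 0 - y))\<^sup>2 * (1 / t) \<le> 2 * (w \<bullet> (y - avg t))"
        using eventually_gt_at_top[of 0] by (rule eventually_mono[rotated])
      then show "\<forall>\<^sub>F t in G. - (norm (u 0 - y))\<^sup>2 * (1 / t) \<le> 2 * (w \<bullet> (y - avg t))"
        by (rule filter_leD[OF G(1)])
    qed
    then show "(0 - w) \<bullet> (p - y) \<ge> 0" by (simp add: inner_diff_right)
  qed
  have unique: "p = q" if G: "G \<le> at_top" "G \<noteq> bot" "(avg \<longlongrightarrow> p) G"
    and H: "H \<le> at_top" "H \<noteq> bot" "(avg \<longlongrightarrow> q) H" for G H p q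
  proof -
    have dist_lim: "\<exists>l. ((\<lambda>t. (norm (u t - z))\<^sup>2) \<longlongrightarrow> l) at_top" if "(z, 0) \<in> A" for z
      using nonincreasing_bounded_below_tendsto[of "\<lambda>t. (norm (u t - z))\<^sup>2" 0]
        solution_contraction[OF u solution_constant[OF that]] by (metis power_mono norm_ge_zero zero_le_power2)
    obtain l l' where l: "((\<lambda>t. (norm (u t - p))\<^sup>2) \<longlongrightarrow> l) at_top"
      "((\<lambda>t. (norm (u t - q))\<^sup>2) \<longlongrightarrow> l') at_top"
      using dist_lim[OF zero[OF G]] dist_lim[OF zero[OF H]] by blast
    define c where "c = (1/2) * (l' - l + ((norm p)\<^sup>2 - (norm q)\<^sup>2))"
    have "u t \<bullet> (p - q) = (1/2) * ((norm (u t - q))\<^sup>2 - (norm (u t - p))\<^sup>2 + ((norm p)\<^sup>2 - (norm q)\<^sup>2))" for t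
      by (simp add: power2_norm_eq_inner inner_diff_left inner_diff_right inner_commute)
    then have "((\<lambda>t. u t \<bullet> (p - q)) \<longlongrightarrow> c) at_top"
      unfolding c_def by (simp only:) (intro tendsto_intros l)
    \<comment> \<open>\<open>avg\<close> therefore has the same inner product with \<open>p - q\<close> at both cluster points\<close>
    then have lim: "((\<lambda>t. avg t \<bullet> (p - q)) \<longlongrightarrow> c) at_top"
      unfolding avg_def by (rule average_tendsto[OF cont])
    have "p \<bullet> (p - q) = c"
      by (rule tendsto_unique[OF G(2) tendsto_inner[OF G(3) tendsto_const] tendsto_mono[OF G(1) lim]])
    moreover have "q \<bullet> (p - q) = c"
      by (rule tendsto_unique[OF H(2) tendsto_inner[OF H(3) tendsto_const] tendsto_mono[OF H(1) lim]])
    ultimately have "(p - q) \<bullet> (p - q) = 0" by (simp add: inner_diff_left)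
    then show ?thesis by simp
  qed
  have "at_top \<noteq> (bot :: real filter)" by simp
  then obtain G x where G: "G \<le> at_top" "G \<noteq> bot" "(avg \<longlongrightarrow> x) G"
    using compact_cluster[OF compact_cball _ avg_bdd] by metis
  have "(avg \<longlongrightarrow> x) at_top"
    by (rule tendsto_if_unique_cluster[OF compact_cball avg_bdd]) (use unique[OF _ _ _ G] in blast)
  then show ?thesis using that[OF zero[OF G]] by (simp add: avg_def[abs_def])
qed

end

section \<open>The operator of the game\<close>

text \<open>
  First-order optimality without differentiability of \<open>F\<close>: compare \<open>y\<close> with the point \<open>y + r (w - y)\<close>, use
  convexity, divide by \<open>r\<close> and let \<open>r\<close> tend to zero. The quadratic term contributes only its
  derivative at \<open>y\<close>.
\<close>

lemma prox_variational:
  fixes F :: "'a::real_inner \<Rightarrow> real"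
  assumes F: "convex_on P F" and h: "h > 0" and y: "y \<in> P" and w: "w \<in> P"
    and min: "\<And>w. w \<in> P \<Longrightarrow> F y + (norm (y - z))\<^sup>2 / (2 * h) \<le> F w + (norm (w - z))\<^sup>2 / (2 * h)"
  shows "F w \<ge> F y + (1 / h) *\<^sub>R (z - y) \<bullet> (w - y)"
proof -
  define c where "c = ((y - z) \<bullet> (w - y)) / h"
  define b where "b = (norm (w - y))\<^sup>2 / (2 * h)"
  have "F w - F y + c + r * b \<ge> 0" if r: "0 < r" "r < 1" for r
  proof -
    define m where "m = (1 - r) *\<^sub>R y + r *\<^sub>R w"
    have "m \<in> P" unfolding m_def using convex_on_imp_convex[OF F] y w r by (intro convexD) auto
    from min[OF this] have "F y + (norm (y - z))\<^sup>2 / (2 * h) \<le> F m + (norm (m - z))\<^sup>2 / (2 * h)" .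
    moreover have "F m \<le> (1 - r) * F y + r * F w"
      unfolding m_def using r y w by (intro convex_onD[OF F]) auto
    moreover have "(norm (m - z))\<^sup>2 / (2 * h) = (norm (y - z))\<^sup>2 / (2 * h) + r * (c + r * b)"
    proof -
      have "(norm (p + r *\<^sub>R q))\<^sup>2 = (norm p)\<^sup>2 + 2 * (r * (p \<bullet> q)) + r * (r * (norm q)\<^sup>2)" for p q :: 'a
        unfolding power2_norm_eq_inner by (simp add: inner_add_left inner_add_right inner_commute)
      moreover have "m - z = (y - z) + r *\<^sub>R (w - y)" by (simp add: m_def algebra_simps)
      ultimately have "(norm (m - z))\<^sup>2 = (norm (y - z))\<^sup>2 + 2 * (r * ((y - z) \<bullet> (w - y))) + r * (r * (norm (w - y))\<^sup>2)"
        by metis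
      then show ?thesis using h by (simp add: c_def b_def field_simps)
    qed
    ultimately have "0 \<le> (1 - r) * F y + r * F w - F y + r * (c + r * b)" by linarith
    also have "\<dots> = r * (F w - F y + c + r * b)" by (simp add: algebra_simps)
    finally show ?thesis using r by (simp add: zero_le_mult_iff)
  qed
  then have "\<forall>\<^sub>F r in at_right 0. 0 \<le> F w - F y + c + r * b"
    using eventually_at_right_less[of "0::real"] eventually_at_right_real[of 0 1]
    by (auto elim: eventually_mono)
  moreover have "((\<lambda>r. F w - F y + c + r * b) \<longlongrightarrow> F w - F y + c + 0 * b) (at_right 0)"
    by (intro tendsto_intros)
  ultimately have "0 \<le> F w - F y + c + 0 * b"
    by (intro tendsto_lowerbound) auto
  moreover have "(1 / h) *\<^sub>R (z - y) \<bullet> (w - y) = - c"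
  proof -
    have "z - y = - (y - z)" by simp
    then show ?thesis unfolding c_def by (metis inner_minus_left inner_scaleR_left mult_minus_right times_divide_eq_left mult_1)
  qed
  ultimately show ?thesis by simp
qed

lemma compact_prod_set:
  assumes "\<And>j. compact (K j)"
  shows "compact (prod_set K)"
proof -
  have "closed (\<Inter>j. (\<lambda>x. x $ j) -` K j)"
    using assms by (intro closed_INT ballI closed_vimage_vec_nth compact_imp_closed)
  also have "(\<Inter>j. (\<lambda>x. x $ j) -` K j) = prod_set K" by (auto simp: prod_set_def)
  finally have "closed (prod_set K)" .
  moreover have "\<forall>j. \<exists>B. \<forall>z\<in>K j. norm z \<le> B"
    using compact_imp_bounded[OF assms] by (simp add: bounded_iff)
  then have "\<exists>B. \<forall>j. \<forall>z\<in>K j. norm z \<le> B j" by (rule choice)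
  then obtain B where B: "\<And>j z. z \<in> K j \<Longrightarrow> norm z \<le> B j" by blast
  have "norm x \<le> (\<Sum>j\<in>UNIV. B j)" if "x \<in> prod_set K" for x
  proof -
    have "norm x \<le> (\<Sum>j\<in>UNIV. norm (x $ j))"
      unfolding norm_vec_def by (rule L2_set_le_sum) auto
    also have "\<dots> \<le> (\<Sum>j\<in>UNIV. B j)"
      using that by (intro sum_mono B) (auto simp: prod_set_def)
    finally show ?thesis .
  qed
  then have "bounded (prod_set K)" unfolding bounded_iff by blast
  ultimately show ?thesis by (simp add: compact_eq_bounded_closed)
qed

lemma convex_prod_set:
  assumes "\<And>j. convex (K j)"
  shows "convex (prod_set K)"
  unfolding convex_def prod_set_def using assms by (auto intro: convexD)

lemma replace_coord_nth [simp]: "replace_coord x j z $ i = (if i = j then z else x $ i)"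
  by (simp add: replace_coord_def)

lemma replace_coord_self [simp]: "replace_coord x j (x $ j) = x"
  by (simp add: vec_eq_iff)

lemma replace_coord_in: "\<lbrakk>x \<in> prod_set K; z \<in> K j\<rbrakk> \<Longrightarrow> replace_coord x j z \<in> prod_set K"
  by (simp add: prod_set_def)

text \<open>
  The total cost when each player \<open>j\<close> alone deviates from \<open>x\<close>, choosing the \<open>j\<close>-th block of \<open>y\<close>. The
  players' minimisations are independent, so minimising over \<open>y\<close> finds all best replies at once, and it
  is for this function of \<open>y\<close> that convexity is assumed.
\<close>

definition reply_cost :: "('n::finite \<Rightarrow> real^'d^'n \<Rightarrow> real) \<Rightarrow> real^'d^'n \<Rightarrow> real^'d^'n \<Rightarrow> real" where
  "reply_cost f x y = (\<Sum>j\<in>UNIV. f j (replace_coord x j (y $ j)))"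

lemma continuous_reply_cost:
  assumes "\<And>j. continuous_on (prod_set K) (f j)"
  shows "continuous_on (prod_set K \<times> prod_set K) (\<lambda>p. reply_cost f (fst p) (snd p))"
  unfolding reply_cost_def
proof (intro continuous_on_sum)
  fix j
  have "continuous_on (prod_set K \<times> prod_set K) (\<lambda>p. replace_coord (fst p) j (snd p $ j))"
    unfolding replace_coord_def
  proof (intro continuous_on_vec_lambda)
    fix i
    show "continuous_on (prod_set K \<times> prod_set K) (\<lambda>p. if i = j then snd p $ j else fst p $ i)"
      by (cases "i = j") (auto intro!: continuous_intros)
  qed
  then show "continuous_on (prod_set K \<times> prod_set K) (\<lambda>p. f j (replace_coord (fst p) j (snd p $ j)))"
    by (rule continuous_on_compose2[OF assms]) (auto simp: prod_set_def)
qed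

definition game_operator ::
    "('n::finite \<Rightarrow> (real^'d) set) \<Rightarrow> ('n \<Rightarrow> real^'d^'n \<Rightarrow> real) \<Rightarrow> ((real^'d^'n) \<times> (real^'d^'n)) set" where
  "game_operator K f = {(x, v). x \<in> prod_set K \<and> (\<forall>j. v $ j \<in> partial_subdiff K f j x)}"

lemma reply_cost_replace_coord:
  "reply_cost f x (replace_coord x j z) = reply_cost f x x + (f j (replace_coord x j z) - f j x)"
proof -
  have "reply_cost f x (replace_coord x j z)
      = (\<Sum>i\<in>UNIV. f i x + (if i = j then f j (replace_coord x j z) - f j x else 0))"
    unfolding reply_cost_def by (intro sum.cong) auto
  also have "\<dots> = (\<Sum>i\<in>UNIV. f i x) + (f j (replace_coord x j z) - f j x)"
    by (simp add: sum.distrib)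
  finally show ?thesis by (simp add: reply_cost_def)
qed

lemma inner_replace_coord: "v \<bullet> (replace_coord x j z - x) = v $ j \<bullet> (z - x $ j)"
proof -
  have "v \<bullet> (replace_coord x j z - x) = (\<Sum>i\<in>UNIV. if i = j then v $ j \<bullet> (z - x $ j) else 0)"
    unfolding inner_vec_def by (intro sum.cong) auto
  then show ?thesis by simp
qed

text \<open>
  A subgradient of the joint reply cost at \<open>y = x\<close> splits into partial subgradients: move one block at a time.
\<close>

lemma game_operator_if_reply_optimal:
  assumes "x \<in> prod_set K"
    and "\<And>y. y \<in> prod_set K \<Longrightarrow> reply_cost f x y \<ge> reply_cost f x x + v \<bullet> (y - x)"
  shows "(x, v) \<in> game_operator K f"
  unfolding game_operator_def partial_subdiff_def
proof (intro CollectI case_prodI conjI allI ballI assms(1))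
  fix j z assume "z \<in> K j"
  then show "f j (replace_coord x j z) \<ge> f j x + v $ j \<bullet> (z - x $ j)"
    using assms(2)[OF replace_coord_in[OF assms(1)], of z j]
    by (simp add: reply_cost_replace_coord inner_replace_coord)
qed

text \<open>
  Existence of a Nash equilibrium for the game with proximal costs. The minimiser \<open>T x\<close> of \<open>\<Phi> x\<close> is unique by
  the variational inequality, so \<open>T\<close> is continuous by compactness, and a fixed point of \<open>T\<close> is an
  equilibrium.
\<close>

lemma game_operator_surjective:
  fixes K :: "'n::finite \<Rightarrow> (real^'d) set" and f :: "'n \<Rightarrow> real^'d^'n \<Rightarrow> real"
  assumes "\<And>j. convex (K j)" "\<And>j. compact (K j)" "prod_set K \<noteq> {}"
    and cont: "\<And>j. continuous_on (prod_set K) (f j)"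
    and conv: "\<And>x. x \<in> prod_set K \<Longrightarrow> convex_on (prod_set K) (reply_cost f x)"
    and h: "h > 0"
  shows "\<exists>x v. (x, v) \<in> game_operator K f \<and> x + h *\<^sub>R v = z"
proof -
  let ?P = "prod_set K"
  define \<Phi> where "\<Phi> x y = reply_cost f x y + (norm (y - z))\<^sup>2 / (2 * h)" for x y
  define minimizer where "minimizer x y \<longleftrightarrow> y \<in> ?P \<and> (\<forall>w\<in>?P. \<Phi> x y \<le> \<Phi> x w)" for x y
  have compact: "compact ?P" using assms(2) by (rule compact_prod_set)
  have cont\<Phi>: "continuous_on (?P \<times> ?P) (\<lambda>p. \<Phi> (fst p) (snd p))"
    unfolding \<Phi>_def using h by (intro continuous_intros continuous_reply_cost cont) auto
  have variational: "reply_cost f x w \<ge> reply_cost f x y + (1 / h) *\<^sub>R (z - y) \<bullet> (w - y)"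
    if "x \<in> ?P" "minimizer x y" "w \<in> ?P" for x y w
    using that by (intro prox_variational[OF conv h]) (auto simp: minimizer_def \<Phi>_def)
  have unique: "y = y'" if x: "x \<in> ?P" and y: "minimizer x y" and y': "minimizer x y'" for x y y'
  proof -
    have "(1 / h) *\<^sub>R (z - y) \<bullet> (y' - y) + (1 / h) *\<^sub>R (z - y') \<bullet> (y - y') \<le> 0"
      using variational[OF x y, of y'] variational[OF x y', of y] y y' by (simp add: minimizer_def)
    also have "(1 / h) *\<^sub>R (z - y) \<bullet> (y' - y) + (1 / h) *\<^sub>R (z - y') \<bullet> (y - y')
        = (1 / h) * ((y' - y) \<bullet> (y' - y))"
      by (simp add: inner_diff_left inner_diff_right algebra_simps)
    finally have "(y' - y) \<bullet> (y' - y) \<le> 0" using h by (simp add: field_simps)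
    then have "(y' - y) \<bullet> (y' - y) = 0" by (metis inner_ge_zero order_antisym)
    then show ?thesis by simp
  qed
  have "\<exists>y. minimizer x y" if "x \<in> ?P" for x
  proof -
    have "continuous_on ?P (\<lambda>y. \<Phi> (fst (x, y)) (snd (x, y)))"
      by (rule continuous_on_compose2[OF cont\<Phi>, of _ "\<lambda>y. (x, y)"])
        (use that in \<open>auto intro!: continuous_intros\<close>)
    then have "continuous_on ?P (\<Phi> x)" by simp
    from continuous_attains_inf[OF compact assms(3) this] show ?thesis
      unfolding minimizer_def by blast
  qed
  then obtain T where T: "\<And>x. x \<in> ?P \<Longrightarrow> minimizer x (T x)" by metis
  then have TP: "T x \<in> ?P" if "x \<in> ?P" for x using that by (simp add: minimizer_def)
  have "continuous_on ?P T"
    unfolding continuous_on_def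
  proof
    fix x assume x: "x \<in> ?P"
    have ev: "\<forall>\<^sub>F x' in at x within ?P. x' \<in> ?P" by (simp add: eventually_at_filter)
    then have evT: "\<forall>\<^sub>F x' in at x within ?P. T x' \<in> ?P" by eventually_elim (rule TP)
    show "(T \<longlongrightarrow> T x) (at x within ?P)"
    proof (rule tendsto_if_unique_cluster[OF compact evT])
      fix G p assume G: "G \<le> at x within ?P" "G \<noteq> bot" "p \<in> ?P" "(T \<longlongrightarrow> p) G"
      have id: "((\<lambda>x'. x') \<longlongrightarrow> x) G" using G(1) tendsto_mono by blast
      note evG = filter_leD[OF G(1) ev]
      have "\<Phi> x p \<le> \<Phi> x w" if w: "w \<in> ?P" for w
      proof (rule tendsto_le[OF G(2)])
        have "((\<lambda>x'. \<Phi> (fst (x', w)) (snd (x', w))) \<longlongrightarrow> \<Phi> (fst (x, w)) (snd (x, w))) G"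
          by (rule continuous_on_tendsto_compose[OF cont\<Phi> tendsto_Pair[OF id tendsto_const]])
            (use x w evG in auto)
        then show "((\<lambda>x'. \<Phi> x' w) \<longlongrightarrow> \<Phi> x w) G" by simp
        have "((\<lambda>x'. \<Phi> (fst (x', T x')) (snd (x', T x'))) \<longlongrightarrow> \<Phi> (fst (x, p)) (snd (x, p))) G"
          by (rule continuous_on_tendsto_compose[OF cont\<Phi> tendsto_Pair[OF id G(4)]])
            (use x G(3) evG TP in \<open>auto elim: eventually_mono\<close>)
        then show "((\<lambda>x'. \<Phi> x' (T x')) \<longlongrightarrow> \<Phi> x p) G" by simp
        show "\<forall>\<^sub>F x' in G. \<Phi> x' (T x') \<le> \<Phi> x' w"
          using evG by eventually_elim (use T w in \<open>auto simp: minimizer_def\<close>)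
      qed
      then show "p = T x" using unique[OF x _ T[OF x]] G(3) by (simp add: minimizer_def)
    qed
  qed
  then obtain x where x: "x \<in> ?P" "T x = x"
    using brouwer[OF compact convex_prod_set[OF assms(1)] assms(3), of T] TP by auto
  have "(x, (1 / h) *\<^sub>R (z - x)) \<in> game_operator K f"
    using x T[OF x(1)] variational by (intro game_operator_if_reply_optimal) auto
  moreover have "x + h *\<^sub>R ((1 / h) *\<^sub>R (z - x)) = z" using h by simp
  ultimately show ?thesis by blast
qed

lemma game_domain_eq: "game_domain K f = Domain (game_operator K f)"
proof -
  have "partial_subdiff K f j x + normal_cone (K j) (x $ j) \<noteq> {} \<longleftrightarrow> partial_subdiff K f j x \<noteq> {}" for j x
  proof -
    have "0 \<in> normal_cone (K j) (x $ j)" by (simp add: normal_cone_def)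
    then show ?thesis by (auto simp: set_plus_def)
  qed
  moreover have "(\<forall>j. partial_subdiff K f j x \<noteq> {}) \<longleftrightarrow> (\<exists>v. \<forall>j. v $ j \<in> partial_subdiff K f j x)" for x
  proof
    assume "\<forall>j. partial_subdiff K f j x \<noteq> {}"
    then have "\<exists>p. \<forall>j. p j \<in> partial_subdiff K f j x" by (intro choice) blast
    then obtain p where "\<And>j. p j \<in> partial_subdiff K f j x" by blast
    then show "\<exists>v. \<forall>j. v $ j \<in> partial_subdiff K f j x" by (intro exI[of _ "\<chi> j. p j"]) simp
  qed auto
  ultimately show ?thesis
    by (auto simp: game_domain_def game_operator_def)
qed

text \<open>
  This identifies the flow of the game with the inclusion \<open>- w \<in> A x\<close>. Given \<open>p\<close>, testing with the replacement of a
  single block shows that \<open>- w - p\<close> is normal to \<open>K j\<close> in each block, and adding normal vectors to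
  subgradients gives subgradients. Conversely \<open>p = - w\<close> makes the sum vanish.
\<close>

lemma game_operator_iff_variational:
  assumes x: "x \<in> prod_set K"
  shows "(x, - w) \<in> game_operator K f \<longleftrightarrow>
    (\<exists>p. (\<forall>j. p j \<in> partial_subdiff K f j x) \<and>
         (\<forall>y\<in>prod_set K. (\<Sum>j\<in>UNIV. (w $ j + p j) \<bullet> (y $ j - x $ j)) \<ge> 0))" (is "?L \<longleftrightarrow> ?R")
proof
  assume ?L
  then show ?R by (intro exI[of _ "\<lambda>j. - (w $ j)"]) (auto simp: game_operator_def)
next
  assume ?R
  then obtain p where p: "\<And>j. p j \<in> partial_subdiff K f j x"
    and ge: "\<And>y. y \<in> prod_set K \<Longrightarrow> (\<Sum>j\<in>UNIV. (w $ j + p j) \<bullet> (y $ j - x $ j)) \<ge> 0" by blast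
  have "f j (replace_coord x j z) \<ge> f j x + (- w) $ j \<bullet> (z - x $ j)" if z: "z \<in> K j" for j z
  proof -
    have "0 \<le> (\<chi> j. w $ j + p j) \<bullet> (replace_coord x j z - x)"
      using ge[OF replace_coord_in[OF x z]] by (simp add: inner_vec_def del: replace_coord_nth)
    then have "0 \<le> (w $ j + p j) \<bullet> (z - x $ j)" by (simp add: inner_replace_coord)
    moreover have "f j (replace_coord x j z) \<ge> f j x + p j \<bullet> (z - x $ j)"
      using p[of j] z by (simp add: partial_subdiff_def)
    ultimately show ?thesis by (simp add: inner_add_left)
  qed
  then show ?L using x by (simp add: game_operator_def partial_subdiff_def)
qed

lemma nash_equilibrium_iff: "nash_equilibrium K f x \<longleftrightarrow> (x, 0) \<in> game_operator K f"
  by (simp add: nash_equilibrium_def game_operator_def partial_subdiff_def)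

theorem proposition3p1:
  fixes K :: "'n::finite \<Rightarrow> (real^'d) set"
    and f :: "'n \<Rightarrow> real^'d^'n \<Rightarrow> real"
    and u0 :: "real^'d^'n"
  assumes "\<And>j. convex (K j)"
    and "\<And>j. compact (K j)"
    and "\<And>j. interior (K j) \<noteq> {}"
    and "\<And>j. continuous_on (prod_set K) (f j)"
    and "\<And>x. x \<in> prod_set K \<Longrightarrow>
           convex_on (prod_set K) (\<lambda>y. \<Sum>j\<in>UNIV. f j (replace_coord x j (y $ j)))"
    and "\<And>x y p q. x \<in> prod_set K \<Longrightarrow> y \<in> prod_set K \<Longrightarrow>
           (\<And>j. p j \<in> partial_subdiff K f j x) \<Longrightarrow>
           (\<And>j. q j \<in> partial_subdiff K f j y) \<Longrightarrow>
           (\<Sum>j\<in>UNIV. (p j - q j) \<bullet> (x $ j - y $ j)) \<ge> 0"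
    and "u0 \<in> game_domain K f"
  shows "\<exists>u. flow_solution K f u0 u \<and>
             (\<forall>v. flow_solution K f u0 v \<longrightarrow> (\<forall>t\<ge>0. v t = u t)) \<and>
             (\<exists>x. ((\<lambda>t. (1 / t) *\<^sub>R integral {0..t} u) \<longlongrightarrow> x) at_top \<and>
                  nash_equilibrium K f x)"
proof -
  interpret maximal_monotone "game_operator K f"
  proof
    fix x v y w assume "(x, v) \<in> game_operator K f" "(y, w) \<in> game_operator K f"
    then show "(v - w) \<bullet> (x - y) \<ge> 0"
      using assms(6)[of x y "\<lambda>j. v $ j" "\<lambda>j. w $ j"] by (simp add: game_operator_def inner_vec_def)
  next
    fix h :: real and z :: "real^'d^'n" assume "h > 0"
    moreover have "prod_set K \<noteq> {}" using assms(7) by (auto simp: game_domain_def)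
    ultimately show "\<exists>x v. (x, v) \<in> game_operator K f \<and> x + h *\<^sub>R v = z"
      using assms(1,2,4,5) by (intro game_operator_surjective) (auto simp: reply_cost_def[abs_def])
  qed
  have flow_iff: "flow_solution K f u0 u \<longleftrightarrow>
      solution u \<and> u 0 = u0 \<and> (\<forall>t\<ge>0. u t \<in> Domain (game_operator K f))" for u
  proof -
    have "(AE t in lebesgue_on {0..}. \<exists>w p. (u has_vector_derivative w) (at t within {0..}) \<and>
              (\<forall>j. p j \<in> partial_subdiff K f j (u t)) \<and>
              (\<forall>y\<in>prod_set K. (\<Sum>j\<in>UNIV. (w $ j + p j) \<bullet> (y $ j - u t $ j)) \<ge> 0))
        \<longleftrightarrow> (AE t in lebesgue_on {0..}. \<exists>w. (u has_vector_derivative w) (at t within {0..}) \<and>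
              (u t, - w) \<in> game_operator K f)"
      if "\<forall>t\<ge>0. u t \<in> Domain (game_operator K f)"
    proof (rule AE_cong)
      fix t :: real assume "t \<in> space (lebesgue_on {0..})"
      then have "u t \<in> prod_set K" using that by (auto simp: game_operator_def)
      from game_operator_iff_variational[OF this]
      show "(\<exists>w p. (u has_vector_derivative w) (at t within {0..}) \<and>
              (\<forall>j. p j \<in> partial_subdiff K f j (u t)) \<and>
              (\<forall>y\<in>prod_set K. (\<Sum>j\<in>UNIV. (w $ j + p j) \<bullet> (y $ j - u t $ j)) \<ge> 0))
        \<longleftrightarrow> (\<exists>w. (u has_vector_derivative w) (at t within {0..}) \<and> (u t, - w) \<in> game_operator K f)"
        by blast
    qed
    then show ?thesis
      unfolding flow_solution_def solution_def game_domain_eq by blast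
  qed
  obtain u where u: "solution u" "u 0 = u0" "\<And>t. 0 \<le> t \<Longrightarrow> u t \<in> Domain (game_operator K f)"
    using solution_exists assms(7) unfolding game_domain_eq by metis
  have "u ` {0..} \<subseteq> prod_set K" using u(3) by (force simp: game_operator_def)
  then have "bounded (u ` {0..})"
    by (rule bounded_subset[OF compact_imp_bounded[OF compact_prod_set[OF assms(2)]]])
  with u(1) obtain x where "(x, 0) \<in> game_operator K f"
    "((\<lambda>t. (1 / t) *\<^sub>R integral {0..t} u) \<longlongrightarrow> x) at_top"
    by (rule solution_average_tendsto)
  moreover have "v t = u t" if "flow_solution K f u0 v" "0 \<le> t" for v t
    using solution_contraction[of v u 0 t] that u by (simp add: flow_iff)
  ultimately show ?thesis
    using u unfolding flow_iff nash_equilibrium_iff by blast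
qed

end
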